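(* Let $\alpha,\beta\in\mathbb{R}$ and $\delta,\varepsilon>0$ satisfy $\alpha\neq\beta$ and $(\alpha-\beta)\delta+\varepsilon^2-\delta^2\neq0$, and let $\mathcal{E}=\{e^{(1)},\dots,e^{(12)}\}$ be the set of transformation strains of monoclinic-I martensite with these lattice parameters. If $\varepsilon<\delta$, then the convex hull of $\mathcal{E}$ has exactly 25 four-dimensional facets, namely the convex hulls of $\{e^{(i)}: i\in I\}$ for the following index sets $I$: (1) 12 facets with 5 vertices each: $\{1,2,3,7,10\}$, $\{1,2,4,6,11\}$, $\{1,3,4,5,9\}$, $\{1,5,7,8,9\}$, $\{1,5,9,11,12\}$, $\{2,3,4,8,12\}$, $\{2,5,6,8,12\}$, $\{2,8,9,10,12\}$, $\{3,5,6,7,10\}$, $\{3,7,10,11,12\}$, $\{4,6,7,8,11\}$, $\{4,6,9,10,11\}$; (2) 4 facets, each of which is a pair of $T_3$s (its vertex set is the union of two disjoint three-tuples each forming a $T_3$) and whose index set is invariant under $r_0$: $\{1,2,5,6,11,12\}$, $\{1,2,7,8,9,10\}$, $\{3,4,5,6,9,10\}$, $\{3,4,7,8,11,12\}$; (3) 6 facets, each of which is a pair of pairwise compatible three-tuples (its vertex set is the union of two disjoint three-tuples, each consisting of pairwise compatible strains): $\{1,2,5,8,9,12\}$, $\{1,3,5,7,9,10\}$, $\{1,4,5,6,9,11\}$, $\{2,3,7,8,10,12\}$, $\{2,4,6,8,11,12\}$, $\{3,4,6,7,10,11\}$; (4) 3 facets with 8 vertices each, each with index set invariant under $r_0$: $\{1,2,3,4,5,6,7,8\}$,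 $\{1,2,3,4,9,10,11,12\}$, $\{5,6,7,8,9,10,11,12\}$.
   Context: Write $M(a,b,c;p,q,s)$ for the real symmetric $3\times 3$ matrix with diagonal entries $a,b,c$, $(1,2)$-entry $p$, $(1,3)$-entry $q$ and $(2,3)$-entry $s$. The twelve transformation strains of monoclinic-I martensite with lattice parameters $\alpha,\beta,\delta,\varepsilon$ are $e^{(1)}=M(\alpha,\alpha,\beta;\delta,\varepsilon,\varepsilon)$, $e^{(2)}=M(\alpha,\alpha,\beta;\delta,-\varepsilon,-\varepsilon)$, $e^{(3)}=M(\alpha,\alpha,\beta;-\delta,-\varepsilon,\varepsilon)$, $e^{(4)}=M(\alpha,\alpha,\beta;-\delta,\varepsilon,-\varepsilon)$, $e^{(5)}=M(\alpha,\beta,\alpha;\varepsilon,\delta,\varepsilon)$, $e^{(6)}=M(\alpha,\beta,\alpha;-\varepsilon,\delta,-\varepsilon)$, $e^{(7)}=M(\alpha,\beta,\alpha;-\varepsilon,-\delta,\varepsilon)$, $e^{(8)}=M(\alpha,\beta,\alpha;\varepsilon,-\delta,-\varepsilon)$, $e^{(9)}=M(\beta,\alpha,\alpha;\varepsilon,\varepsilon,\delta)$, $e^{(10)}=M(\beta,\alpha,\alpha;-\varepsilon,-\varepsilon,\delta)$, $e^{(11)}=M(\beta,\alpha,\alpha;-\varepsilon,\varepsilon,-\delta)$, $e^{(12)}=M(\beta,\alpha,\alpha;\varepsilon,-\varepsilon,-\delta)$. The convex hull of $\mathcal{E}$ is a five-dimensional polytope (in the affine space of symmetric matrices of trace $2\alpha+\beta$);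 its facets are its extreme subsets (faces) of codimension one. $r_0$ is the permutation of $\{1,\dots,12\}$ interchanging $1\leftrightarrow2$, $3\leftrightarrow4$, $5\leftrightarrow6$, $7\leftrightarrow8$, $9\leftrightarrow10$, $11\leftrightarrow12$. Two real symmetric $3\times3$ matrices $e,f$ are compatible if there exist $a,b\in\mathbb{R}^3$ with $e-f=\frac12(a\otimes b+b\otimes a)$; otherwise incompatible. With $(e,f)=\{\lambda e+(1-\lambda)f:\lambda\in(0,1)\}$, three real symmetric $3\times3$ matrices $e_1,e_2,e_3$ with equal trace form a $T_3$ if they are pairwise incompatible and there exist $e_{1,1}\in(e_2,e_3)$, $e_{2,2}\in(e_3,e_1)$, $e_{3,3}\in(e_1,e_2)$ such that $e_{i,i}$ is compatible with $e_i$ for $i=1,2,3$. *)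

theory Defs
  imports "HOL-Analysis.Analysis"
begin

definition symm33 :: "real \<Rightarrow> real \<Rightarrow> real \<Rightarrow> real \<Rightarrow> real \<Rightarrow> real \<Rightarrow> real^3^3" where
  "symm33 a b c p q s = vector [vector [a, p, q], vector [p, b, s], vector [q, s, c]]"

(* Indices run over {1..12}, as in the literature, hence the shift by one. *)
definition strain :: "real \<Rightarrow> real \<Rightarrow> real \<Rightarrow> real \<Rightarrow> nat \<Rightarrow> real^3^3" where
  "strain \<alpha> \<beta> \<delta> \<epsilon> i =
    [symm33 \<alpha> \<alpha> \<beta>    \<delta>    \<epsilon>    \<epsilon>,
     symm33 \<alpha> \<alpha> \<beta>    \<delta>  (-\<epsilon>) (-\<epsilon>),
     symm33 \<alpha> \<alpha> \<beta>  (-\<delta>) (-\<epsilon>)   \<epsilon>,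
     symm33 \<alpha> \<alpha> \<beta>  (-\<delta>)   \<epsilon>  (-\<epsilon>),
     symm33 \<alpha> \<beta> \<alpha>    \<epsilon>    \<delta>    \<epsilon>,
     symm33 \<alpha> \<beta> \<alpha>  (-\<epsilon>)   \<delta>  (-\<epsilon>),
     symm33 \<alpha> \<beta> \<alpha>  (-\<epsilon>) (-\<delta>)   \<epsilon>,
     symm33 \<alpha> \<beta> \<alpha>    \<epsilon>  (-\<delta>) (-\<epsilon>),
     symm33 \<beta> \<alpha> \<alpha>    \<epsilon>    \<epsilon>    \<delta>,
     symm33 \<beta> \<alpha> \<alpha>  (-\<epsilon>) (-\<epsilon>)   \<delta>,
     symm33 \<beta> \<alpha> \<alpha>  (-\<epsilon>)   \<epsilon>  (-\<delta>),
     symm33 \<beta> \<alpha> \<alpha>    \<epsilon>  (-\<epsilon>) (-\<delta>)] ! (i - 1)"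

definition outer :: "real^3 \<Rightarrow> real^3 \<Rightarrow> real^3^3" (infixl "\<otimes>\<^sub>v" 70) where
  "a \<otimes>\<^sub>v b = (\<chi> i j. a $ i * b $ j)"

definition compatible :: "real^3^3 \<Rightarrow> real^3^3 \<Rightarrow> bool" where
  "compatible e f \<longleftrightarrow> (\<exists>a b. e - f = (1/2) *\<^sub>R (a \<otimes>\<^sub>v b + b \<otimes>\<^sub>v a))"

(* Unlike the library's open_segment, this is {e}, not empty, when e = f. *)
definition mixtures :: "real^3^3 \<Rightarrow> real^3^3 \<Rightarrow> (real^3^3) set" where
  "mixtures e f = {t *\<^sub>R e + (1 - t) *\<^sub>R f | t. t \<in> {0<..<1}}"

definition forms_T3 :: "real^3^3 \<Rightarrow> real^3^3 \<Rightarrow> real^3^3 \<Rightarrow> bool" where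
  "forms_T3 e1 e2 e3 \<longleftrightarrow>
     transpose e1 = e1 \<and> transpose e2 = e2 \<and> transpose e3 = e3 \<and>
     trace e1 = trace e2 \<and> trace e2 = trace e3 \<and>
     \<not> compatible e1 e2 \<and> \<not> compatible e2 e3 \<and> \<not> compatible e3 e1 \<and>
     (\<exists>e11 \<in> mixtures e2 e3. \<exists>e22 \<in> mixtures e3 e1. \<exists>e33 \<in> mixtures e1 e2.
        compatible e11 e1 \<and> compatible e22 e2 \<and> compatible e33 e3)"

definition T3_pair :: "(real^3^3) set \<Rightarrow> bool" where
  "T3_pair V \<longleftrightarrow>
     (\<exists>x1 x2 x3 y1 y2 y3. distinct [x1, x2, x3, y1, y2, y3] \<and>
        V = {x1, x2, x3} \<union> {y1, y2, y3} \<and> forms_T3 x1 x2 x3 \<and> forms_T3 y1 y2 y3)"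

definition compatible_triple :: "real^3^3 \<Rightarrow> real^3^3 \<Rightarrow> real^3^3 \<Rightarrow> bool" where
  "compatible_triple e1 e2 e3 \<longleftrightarrow> compatible e1 e2 \<and> compatible e2 e3 \<and> compatible e3 e1"

definition compatible_triple_pair :: "(real^3^3) set \<Rightarrow> bool" where
  "compatible_triple_pair V \<longleftrightarrow>
     (\<exists>x1 x2 x3 y1 y2 y3. distinct [x1, x2, x3, y1, y2, y3] \<and>
        V = {x1, x2, x3} \<union> {y1, y2, y3} \<and>
        compatible_triple x1 x2 x3 \<and> compatible_triple y1 y2 y3)"

definition vertices :: "(real^3^3) set \<Rightarrow> (real^3^3) set" where
  "vertices S = {x. x extreme_point_of S}"

(* The permutation (1 2)(3 4)(5 6)(7 8)(9 10)(11 12). *)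
definition r0 :: "nat \<Rightarrow> nat" where
  "r0 i = (if i \<in> {1..12} then if odd i then i + 1 else i - 1 else i)"

definition simplex_indices :: "nat set set" where
  "simplex_indices =
    {{1,2,3,7,10}, {1,2,4,6,11}, {1,3,4,5,9}, {1,5,7,8,9},
     {1,5,9,11,12}, {2,3,4,8,12}, {2,5,6,8,12}, {2,8,9,10,12},
     {3,5,6,7,10}, {3,7,10,11,12}, {4,6,7,8,11}, {4,6,9,10,11}}"

definition T3_pair_indices :: "nat set set" where
  "T3_pair_indices =
    {{1,2,5,6,11,12}, {1,2,7,8,9,10}, {3,4,5,6,9,10}, {3,4,7,8,11,12}}"

definition compatible_pair_indices :: "nat set set" where
  "compatible_pair_indices =
    {{1,2,5,8,9,12}, {1,3,5,7,9,10}, {1,4,5,6,9,11},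
     {2,3,7,8,10,12}, {2,4,6,8,11,12}, {3,4,6,7,10,11}}"

definition eight_vertex_indices :: "nat set set" where
  "eight_vertex_indices =
    {{1,2,3,4,5,6,7,8}, {1,2,3,4,9,10,11,12}, {5,6,7,8,9,10,11,12}}"

end

theory Submission
  imports Defs
begin

text \<open>
  Each strain consists of a diagonal, on which \<open>\<beta>\<close> occupies one of three places, and of an
  off-diagonal vector with entries \<open>\<plusminus>\<delta>, \<plusminus>\<epsilon>, \<plusminus>\<epsilon>\<close>.  The place of \<open>\<beta>\<close> determines that of \<open>\<plusminus>\<delta>\<close>, which
  divides the strains into three families of four; inside a family the signs run through the four
  patterns with product \<open>1\<close>.  Since \<open>\<alpha> \<noteq> \<beta>\<close>, an affine functional on the hull amounts to one
  constant \<open>d k\<close> for each family and one vector \<open>c\<close> acting on the off-diagonal parts.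

  A face is given by a functional whose slacks (\<open>gap\<close> below) are nonnegative on the twelve strains,
  and its vertices are those with slack zero.  If \<open>c = 0\<close> some family is missing, and the vertices
  lie in one of the three sets of eight.  If \<open>c \<noteq> 0\<close>, only the strains optimal in their
  family for \<open>c\<close> can have slack zero.  Because an even number of sign reversals permutes each
  family, either all \<open>c l\<close> can be taken nonnegative, and then the vertices agree in one sign
  (compatible pairs); or all can be taken negative, the unattainable optimum is the pattern of three
  minus signs, and exactly one sign has to be reversed at the least cost.  Here \<open>\<epsilon> < \<delta>\<close> decides: a
  unique smallest coefficient leads to the simplices, a tie to the pairs of \<open>T\<^sub>3\<close>s.  This is
  \<open>tight_set_covered\<close>.  Conversely \<open>supporting_functional_exists\<close> gives a functional
  for each of the 25 sets, and these sets form an antichain, so \<open>facets_of_convex_hull_eqI\<close>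
  identifies them with the facets without any computation of their dimensions.

  The matrices \<open>e - f\<close> have trace zero, and for those compatibility means \<open>det (e - f) = 0\<close>
  (\<open>compatible_iff_det_eq_0\<close>).  Strains with a common sign pattern are therefore pairwise compatible.
  In the triples that make up the pairs of \<open>T\<^sub>3\<close>s the cyclic differences share the determinant
  \<open>\<plusminus> 4 \<epsilon> ((\<alpha> - \<beta>) \<delta> + \<epsilon>\<^sup>2 - \<delta>\<^sup>2)\<close>, which is nonzero by hypothesis; the cubic \<open>det\<close> then changes sign
  along each side of the triangle, and the intermediate value theorem gives the three mixtures of a
  \<open>T\<^sub>3\<close> (\<open>forms_T3I\<close>).
\<close>

section \<open>Compatibility as a vanishing determinant\<close>

lemma symm33_nth [simp]:
  "symm33 a b c p q s $ 1 $ 1 = a" "symm33 a b c p q s $ 2 $ 2 = b" "symm33 a b c p q s $ 3 $ 3 = c"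
  "symm33 a b c p q s $ 1 $ 2 = p" "symm33 a b c p q s $ 2 $ 1 = p"
  "symm33 a b c p q s $ 1 $ 3 = q" "symm33 a b c p q s $ 3 $ 1 = q"
  "symm33 a b c p q s $ 2 $ 3 = s" "symm33 a b c p q s $ 3 $ 2 = s"
  by (simp_all add: symm33_def)

lemma symm33_eq_iff:
  "symm33 a b c p q s = symm33 a' b' c' p' q' s' \<longleftrightarrow>
     a = a' \<and> b = b' \<and> c = c' \<and> p = p' \<and> q = q' \<and> s = s'"
  by (auto simp: vec_eq_iff forall_3)

lemma symm33_linear:
  "symm33 a b c p q s + symm33 a' b' c' p' q' s' = symm33 (a+a') (b+b') (c+c') (p+p') (q+q') (s+s')"
  "symm33 a b c p q s - symm33 a' b' c' p' q' s' = symm33 (a-a') (b-b') (c-c') (p-p') (q-q') (s-s')"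
  "r *\<^sub>R symm33 a b c p q s = symm33 (r*a) (r*b) (r*c) (r*p) (r*q) (r * s)"
  by (simp_all add: vec_eq_iff forall_3)

lemma transpose_symm33 [simp]: "transpose (symm33 a b c p q s) = symm33 a b c p q s"
  by (simp add: vec_eq_iff forall_3 transpose_def)

lemma trace_symm33 [simp]: "trace (symm33 a b c p q s) = a + b + c"
  by (simp add: trace_def sum_3)

lemma det_symm33:
  "det (symm33 a b c p q s) = a*b*c + 2*p*q * s - a * s\<^sup>2 - b*q\<^sup>2 - c*p\<^sup>2"
  by (simp add: det_3 power2_eq_square algebra_simps)

lemma symmetric_eq_symm33:
  fixes A :: "real^3^3"
  assumes "transpose A = A"
  shows "A = symm33 (A$1$1) (A$2$2) (A$3$3) (A$1$2) (A$1$3) (A$2$3)"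
proof -
  have "A $ j $ i = A $ i $ j" for i j
    using arg_cong[OF assms, of "\<lambda>M. M $ i $ j"] by (simp add: transpose_def)
  from this[of 1 2] this[of 1 3] this[of 2 3] show ?thesis
    by (simp add: vec_eq_iff forall_3)
qed

text \<open>A symmetric matrix of trace and determinant zero is the matrix of a product of two linear
  forms.  Completing the square in the first variable leaves the binary form with coefficients
  \<open>p\<^sup>2 - a b\<close>, \<open>p q - a s\<close>, \<open>q\<^sup>2 - a c\<close>, which is a square up to sign because the determinant
  vanishes; the difference of two squares then factors.  The sign is right because the three
  principal \<open>2 \<times> 2\<close> minors have a common sign (the adjugate has rank at most one), while their sum
  is negative for a nonzero matrix of trace zero.\<close>

lemma quadratic_form_factors_aux:
  fixes a b c p q s :: real
  assumes a: "a \<noteq> 0" and tr: "a + b + c = 0"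
    and det: "a*b*c + 2*p*q * s - a * s\<^sup>2 - b*q\<^sup>2 - c*p\<^sup>2 = 0"
  shows "\<exists>(u::real^3) (v::real^3). u$1 * v$1 = a \<and> u$2 * v$2 = b \<and> u$3 * v$3 = c \<and>
           u$1 * v$2 + u$2 * v$1 = 2*p \<and> u$1 * v$3 + u$3 * v$1 = 2*q \<and>
           u$2 * v$3 + u$3 * v$2 = 2 * s"
proof -
  define A B C where "A = p\<^sup>2 - a*b" and "B = q\<^sup>2 - a*c" and "C = s\<^sup>2 - b*c"
  have AB: "A * B = (p*q - a * s)\<^sup>2"
  proof -
    have "A * B - (p*q - a * s)\<^sup>2 = a * (a*b*c + 2*p*q * s - a * s\<^sup>2 - b*q\<^sup>2 - c*p\<^sup>2)"
      unfolding A_def B_def by (simp add: algebra_simps power2_eq_square)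
    then show ?thesis using det by simp
  qed
  have AC: "A * C = (p * s - b*q)\<^sup>2"
  proof -
    have "A * C - (p * s - b*q)\<^sup>2 = b * (a*b*c + 2*p*q * s - a * s\<^sup>2 - b*q\<^sup>2 - c*p\<^sup>2)"
      unfolding A_def C_def by (simp add: algebra_simps power2_eq_square)
    then show ?thesis using det by simp
  qed
  have BC: "B * C = (q * s - c*p)\<^sup>2"
  proof -
    have "B * C - (q * s - c*p)\<^sup>2 = c * (a*b*c + 2*p*q * s - a * s\<^sup>2 - b*q\<^sup>2 - c*p\<^sup>2)"
      unfolding B_def C_def by (simp add: algebra_simps power2_eq_square)
    then show ?thesis using det by simp
  qed
  have sum: "A + B + C > 0"
  proof -
    have c: "c = - a - b" using tr by simp
    have "A + B + C = p\<^sup>2 + q\<^sup>2 + s\<^sup>2 + (a\<^sup>2 + b\<^sup>2 + c\<^sup>2) / 2"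
      unfolding A_def B_def C_def c by (simp add: algebra_simps power2_eq_square)
    moreover have "a\<^sup>2 > 0" using a by simp
    ultimately show ?thesis
      by (smt (verit) zero_le_power2 half_gt_zero)
  qed
  have nonneg: "X \<ge> 0" if "X * Y = y\<^sup>2" "X * Z = z\<^sup>2" "X + Y + Z > 0" for X Y Z y z :: real
  proof (rule ccontr)
    assume "\<not> X \<ge> 0"
    then have X: "X < 0" by simp
    have "X * Y \<ge> 0" "X * Z \<ge> 0" using that by simp_all
    then have "Y \<le> 0" "Z \<le> 0"
      using X by (simp_all add: zero_le_mult_iff)
    with X that(3) show False by linarith
  qed
  have A0: "A \<ge> 0" using nonneg[OF AB AC sum] .
  have B0: "B \<ge> 0"
    by (rule nonneg[of B A "p*q - a * s" C]) (use AB BC sum in \<open>simp_all add: mult.commute add_ac\<close>)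
  define L M where "L = sqrt A" and "M = (if p*q - a * s \<ge> 0 then sqrt B else - sqrt B)"
  have L: "L\<^sup>2 = p\<^sup>2 - a*b" using A0 by (simp add: L_def A_def)
  have M: "M\<^sup>2 = q\<^sup>2 - a*c" using B0 by (simp add: M_def B_def)
  have "sqrt A * sqrt B = \<bar>p*q - a * s\<bar>"
    by (metis AB real_sqrt_abs real_sqrt_mult)
  then have LM: "L * M = p*q - a * s" by (auto simp: L_def M_def)
  have "a * ((p-L)/a) + (p+L)*1 = 2*p" "a * ((q-M)/a) + (q+M)*1 = 2*q"
    using a by simp_all
  moreover have "(p+L) * ((p-L)/a) = b" "(q+M) * ((q-M)/a) = c"
    using a L M by (simp_all add: field_simps power2_eq_square)
  moreover have "(p+L) * ((q-M)/a) + (q+M) * ((p-L)/a) = 2 * s"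
  proof -
    have "(p+L) * (q-M) + (q+M) * (p-L) = 2 * (p*q - L*M)" by (simp add: algebra_simps)
    also have "\<dots> = 2 * a * s" using LM by simp
    finally show ?thesis using a by (simp add: add_divide_distrib[symmetric])
  qed
  ultimately show ?thesis
    by - (rule exI[of _ "vector [a, p+L, q+M]"],
          rule exI[of _ "vector [1, (p-L)/a, (q-M)/a]"], simp)
qed

lemma quadratic_form_factors:
  fixes a b c p q s :: real
  assumes tr: "a + b + c = 0"
    and det: "a*b*c + 2*p*q * s - a * s\<^sup>2 - b*q\<^sup>2 - c*p\<^sup>2 = 0"
  shows "\<exists>(u::real^3) (v::real^3). u$1 * v$1 = a \<and> u$2 * v$2 = b \<and> u$3 * v$3 = c \<and>
           u$1 * v$2 + u$2 * v$1 = 2*p \<and> u$1 * v$3 + u$3 * v$1 = 2*q \<and>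
           u$2 * v$3 + u$3 * v$2 = 2 * s"
proof -
  consider "a \<noteq> 0" | "b \<noteq> 0" | "c \<noteq> 0" | "a = 0" "b = 0" "c = 0" by blast
  then show ?thesis
  proof cases
    case 1
    then show ?thesis using quadratic_form_factors_aux tr det by blast
  next
    case 2
    have "b*a*c + 2*p * s*q - b*q\<^sup>2 - a * s\<^sup>2 - c*p\<^sup>2 = 0" "b + a + c = 0"
      using det tr by (simp_all add: algebra_simps)
    from quadratic_form_factors_aux[OF 2 this(2,1)] obtain u v :: "real^3" where
      "u$1 * v$1 = b" "u$2 * v$2 = a" "u$3 * v$3 = c"
      "u$1 * v$2 + u$2 * v$1 = 2*p" "u$1 * v$3 + u$3 * v$1 = 2 * s" "u$2 * v$3 + u$3 * v$2 = 2*q" by blast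
    then show ?thesis
      by - (rule exI[of _ "vector [u$2, u$1, u$3]"],
          rule exI[of _ "vector [v$2, v$1, v$3]"], simp add: add.commute)
  next
    case 3
    have "c*b*a + 2 * s*q*p - c*p\<^sup>2 - b*q\<^sup>2 - a * s\<^sup>2 = 0" "c + b + a = 0"
      using det tr by (simp_all add: algebra_simps)
    from quadratic_form_factors_aux[OF 3 this(2,1)] obtain u v :: "real^3" where
      "u$1 * v$1 = c" "u$2 * v$2 = b" "u$3 * v$3 = a"
      "u$1 * v$2 + u$2 * v$1 = 2 * s" "u$1 * v$3 + u$3 * v$1 = 2*q" "u$2 * v$3 + u$3 * v$2 = 2*p" by blast
    then show ?thesis
      by - (rule exI[of _ "vector [u$3, u$2, u$1]"],
          rule exI[of _ "vector [v$3, v$2, v$1]"], simp add: add.commute)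
  next
    case 4
    then have "p = 0 \<or> q = 0 \<or> s = 0" using det by simp
    then show ?thesis
    proof (elim disjE)
      assume "p = 0"
      with 4 show ?thesis
        by - (rule exI[of _ "vector [2*q, 2 * s, 0]"],
          rule exI[of _ "vector [0, 0, 1]"], simp)
    next
      assume "q = 0"
      with 4 show ?thesis
        by - (rule exI[of _ "vector [2*p, 0, 2 * s]"],
          rule exI[of _ "vector [0, 1, 0]"], simp)
    next
      assume "s = 0"
      with 4 show ?thesis
        by - (rule exI[of _ "vector [0, 2*p, 2*q]"],
          rule exI[of _ "vector [1, 0, 0]"], simp)
    qed
  qed
qed

text \<open>A matrix \<open>a \<otimes> b + b \<otimes> a\<close> has rank at most two; conversely the factorization of the
  quadratic form of \<open>e - f\<close> into linear forms gives the two vectors.\<close>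

lemma compatible_iff_det_eq_0:
  assumes "transpose e = e" "transpose f = f" "trace e = trace f"
  shows "compatible e f \<longleftrightarrow> det (e - f) = 0"
proof
  assume "compatible e f"
  then obtain a b where ab: "e - f = (1/2) *\<^sub>R (a \<otimes>\<^sub>v b + b \<otimes>\<^sub>v a)"
    by (auto simp: compatible_def)
  show "det (e - f) = 0"
    unfolding ab by (simp add: det_3 outer_def algebra_simps)
next
  define D where "D = e - f"
  have "transpose D = D"
    using assms by (simp add: D_def transpose_def vec_eq_iff)
  then obtain a b c p q s where D: "D = symm33 a b c p q s"
    using symmetric_eq_symm33 by blast
  have "trace D = 0"
    using assms by (simp add: D_def trace_def sum_subtractf)
  then have tr: "a + b + c = 0" by (simp add: D)
  assume "det (e - f) = 0"
  then have "a*b*c + 2*p*q * s - a * s\<^sup>2 - b*q\<^sup>2 - c*p\<^sup>2 = 0"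
    by (simp add: D_def[symmetric] D det_symm33)
  then obtain u v :: "real^3" where
    "u$1 * v$1 = a" "u$2 * v$2 = b" "u$3 * v$3 = c"
    "u$1 * v$2 + u$2 * v$1 = 2*p" "u$1 * v$3 + u$3 * v$1 = 2*q" "u$2 * v$3 + u$3 * v$2 = 2 * s"
    using quadratic_form_factors[OF tr] by blast
  then have "D = (1/2) *\<^sub>R (u \<otimes>\<^sub>v v + v \<otimes>\<^sub>v u)"
    unfolding D by (simp add: vec_eq_iff forall_3 outer_def algebra_simps)
  then show "compatible e f"
    unfolding compatible_def D_def by blast
qed

lemma det_minus_commute: "det (x - y) = - det (y - x)" for x y :: "real^3^3"
  by (simp add: det_3 algebra_simps)

text \<open>The determinant of \<open>t y + (1-t) z - x\<close> is \<open>K\<close> at \<open>t = 0\<close> and \<open>-K\<close> at \<open>t = 1\<close>, because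
  \<open>3 \<times> 3\<close> determinants are odd.  It therefore vanishes strictly in between.\<close>

lemma compatible_mixture_exists:
  fixes x y z :: "real^3^3"
  assumes sym: "transpose x = x" "transpose y = y" "transpose z = z"
    and tr: "trace x = trace y" "trace y = trace z"
    and K: "det (x - y) = K" "det (z - x) = K" "K \<noteq> 0"
  shows "\<exists>m \<in> mixtures y z. compatible m x"
proof -
  define m where "m = (\<lambda>t::real. t *\<^sub>R y + (1 - t) *\<^sub>R z)"
  define g where "g = (\<lambda>t. det (m t - x))"
  have cont: "continuous_on {0..1} g"
    unfolding g_def m_def by (simp add: det_3) (intro continuous_intros)
  have g0: "g 0 = K" and g1: "g 1 = - K"
    using K by (simp_all add: g_def m_def det_minus_commute[of y x])
  have "\<exists>t\<ge>0. t \<le> 1 \<and> g t = 0"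
  proof (cases "K < 0")
    case True
    then show ?thesis using IVT'[of g 0 0 1] g0 g1 cont by auto
  next
    case False
    then show ?thesis using IVT2'[of g 1 0 0] g0 g1 cont by auto
  qed
  then obtain t where t: "0 \<le> t" "t \<le> 1" "g t = 0" by blast
  moreover have "t \<noteq> 0" "t \<noteq> 1" using t g0 g1 K by auto
  ultimately have mix: "m t \<in> mixtures y z"
    by (auto simp: mixtures_def m_def intro!: exI[of _ t])
  have "transpose (m t) = m t"
    using sym by (simp add: m_def transpose_def vec_eq_iff)
  moreover have "trace (m t) = trace x"
  proof -
    have "trace (m t) = t * trace y + (1 - t) * trace z"
      by (simp add: m_def trace_def sum.distrib sum_distrib_left)
    also have "\<dots> = trace x" using tr by (simp add: algebra_simps)
    finally show ?thesis .
  qed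
  ultimately have "compatible (m t) x"
    using compatible_iff_det_eq_0 sym t(3) by (simp add: g_def)
  with mix show ?thesis by blast
qed

text \<open>Equal determinants of the three cyclic differences are what makes the sign change in the
  intermediate value argument available at each of the three vertices.\<close>

lemma forms_T3I:
  assumes sym: "transpose x = x" "transpose y = y" "transpose z = z"
    and tr: "trace x = trace y" "trace y = trace z"
    and K: "det (x - y) = K" "det (y - z) = K" "det (z - x) = K" "K \<noteq> 0"
  shows "forms_T3 x y z"
proof -
  have tr': "trace z = trace x" using tr by simp
  have "\<not> compatible x y" "\<not> compatible y z" "\<not> compatible z x"
    using assms by (simp_all add: compatible_iff_det_eq_0)
  moreover have "\<exists>m \<in> mixtures y z. compatible m x" "\<exists>m \<in> mixtures z x. compatible m y"
      "\<exists>m \<in> mixtures x y. compatible m z"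
    by (rule compatible_mixture_exists[OF sym tr K(1,3,4)]
        compatible_mixture_exists[OF sym(2,3,1) tr(2) tr' K(2,1,4)]
        compatible_mixture_exists[OF sym(3,1,2) tr' tr(1) K(3,2,4)])+
  ultimately show ?thesis
    using sym tr unfolding forms_T3_def by blast
qed

section \<open>Facets of the convex hull of finitely many points\<close>

text \<open>Every face of the hull of a finite set is the hull of some of its points; on a supporting
  hyperplane these can only be the points at which the functional is tight.\<close>

lemma convex_hull_Int_supporting_hyperplane:
  fixes e :: "'i \<Rightarrow> 'a::euclidean_space"
  assumes "finite N" and le: "\<And>i. i \<in> N \<Longrightarrow> a \<bullet> e i \<le> b"
    and I: "\<And>i. i \<in> N \<Longrightarrow> a \<bullet> e i = b \<longleftrightarrow> i \<in> I" "I \<subseteq> N"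
  shows "convex hull (e ` N) \<inter> {x. a \<bullet> x = b} = convex hull (e ` I)"
    and "convex hull (e ` I) face_of convex hull (e ` N)"
proof -
  let ?P = "convex hull (e ` N)"
  have sub: "?P \<subseteq> {x. a \<bullet> x \<le> b}"
    by (rule hull_minimal) (use le in \<open>auto simp: convex_halfspace_le\<close>)
  have face: "?P \<inter> {x. a \<bullet> x = b} face_of ?P"
    by (rule face_of_Int_supporting_hyperplane_le) (use sub in auto)
  obtain S where S: "S \<subseteq> e ` N" "?P \<inter> {x. a \<bullet> x = b} = convex hull S"
    using face_of_convex_hull_subset[OF finite_imp_compact face] \<open>finite N\<close> by blast
  have "S \<subseteq> {x. a \<bullet> x = b}" using S hull_subset[of S convex] by blast
  then have "S \<subseteq> e ` I" using S(1) I(1) by blast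
  then have "?P \<inter> {x. a \<bullet> x = b} \<subseteq> convex hull (e ` I)"
    unfolding S by (rule hull_mono)
  moreover have "convex hull (e ` I) \<subseteq> {x. a \<bullet> x = b}"
    by (rule hull_minimal) (use I in \<open>auto simp: convex_hyperplane\<close>)
  moreover have "convex hull (e ` I) \<subseteq> ?P"
    by (intro hull_mono image_mono I)
  ultimately show eq: "?P \<inter> {x. a \<bullet> x = b} = convex hull (e ` I)" by blast
  show "convex hull (e ` I) face_of ?P" using face eq by simp
qed

text \<open>A facet is a maximal proper face, and every nonempty proper face lies in a facet.  Hence a family of
  faces that catches every proper face is, once it is an antichain, the family of all facets; no
  dimension has to be computed.\<close>

proposition facets_of_convex_hull_eqI:
  fixes e :: "'i \<Rightarrow> 'a::euclidean_space"
  assumes fin: "finite N"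
    and supp: "\<And>I. I \<in> \<I> \<Longrightarrow> I \<noteq> {} \<and> I \<subset> N \<and>
                 (\<exists>a b. \<forall>i\<in>N. a \<bullet> e i \<le> b \<and> (a \<bullet> e i = b \<longleftrightarrow> i \<in> I))"
    and cover: "\<And>a b. (\<forall>i\<in>N. a \<bullet> e i \<le> b) \<Longrightarrow> \<exists>i\<in>N. a \<bullet> e i \<noteq> b \<Longrightarrow>
                 \<exists>I\<in>\<I>. {i\<in>N. a \<bullet> e i = b} \<subseteq> I"
    and antichain: "\<And>I J. I \<in> \<I> \<Longrightarrow> J \<in> \<I> \<Longrightarrow> I \<subseteq> J \<Longrightarrow> I = J"
  shows "{F. F facet_of convex hull (e ` N)} = (\<lambda>I. convex hull (e ` I)) ` \<I>"
    and "\<And>I i. I \<in> \<I> \<Longrightarrow> i \<in> N \<Longrightarrow> e i \<in> convex hull (e ` I) \<longleftrightarrow> i \<in> I"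
    and "\<And>I. I \<in> \<I> \<Longrightarrow> convex hull (e ` I) face_of convex hull (e ` N)"
proof -
  let ?P = "convex hull (e ` N)" and ?H = "\<lambda>I. convex hull (e ` I)"
  have in_N: "e i \<in> ?P" if "i \<in> N" for i
    using that by (simp add: hull_inc)
  show mem: "e i \<in> ?H I \<longleftrightarrow> i \<in> I" if I: "I \<in> \<I>" and i: "i \<in> N" for I i
  proof -
    obtain a b where ab: "\<And>i. i \<in> N \<Longrightarrow> a \<bullet> e i \<le> b" "\<And>i. i \<in> N \<Longrightarrow> a \<bullet> e i = b \<longleftrightarrow> i \<in> I"
      using supp[OF I] by blast
    have "I \<subseteq> N" using supp[OF I] by blast
    from convex_hull_Int_supporting_hyperplane(1)[OF fin ab this]
    show ?thesis using in_N[OF i] ab(2)[OF i] by blast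
  qed
  show face: "?H I face_of ?P" if I: "I \<in> \<I>" for I
  proof -
    obtain a b where ab: "\<And>i. i \<in> N \<Longrightarrow> a \<bullet> e i \<le> b" "\<And>i. i \<in> N \<Longrightarrow> a \<bullet> e i = b \<longleftrightarrow> i \<in> I"
      using supp[OF I] by blast
    have "I \<subseteq> N" using supp[OF I] by blast
    from convex_hull_Int_supporting_hyperplane(2)[OF fin ab this]
    show ?thesis .
  qed
  have proper: "?H I \<noteq> ?P" if "I \<in> \<I>" for I
    using supp[OF that] mem[OF that] in_N by blast
  have poly: "polyhedron ?P"
    using fin by (simp add: polyhedron_convex_hull)
  have facet_in: "F \<in> ?H ` \<I>" if F: "F facet_of ?P" for F
  proof -
    have "F exposed_face_of ?P"
      using F poly exposed_face_of_polyhedron facet_of_imp_face_of by blast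
    then obtain a b where ab: "?P \<subseteq> {x. a \<bullet> x \<le> b}" "F = ?P \<inter> {x. a \<bullet> x = b}"
      unfolding exposed_face_of_def by blast
    have le: "\<forall>i\<in>N. a \<bullet> e i \<le> b" using ab in_N by blast
    define Z where "Z = {i\<in>N. a \<bullet> e i = b}"
    have FZ: "F = ?H Z"
      unfolding ab(2) by (rule convex_hull_Int_supporting_hyperplane(1)[OF fin])
        (use le in \<open>auto simp: Z_def\<close>)
    have "F \<noteq> ?P" using F by auto
    then have "Z \<noteq> N" using FZ by blast
    then have "\<exists>i\<in>N. a \<bullet> e i \<noteq> b" by (auto simp: Z_def)
    with cover[OF le] obtain I where I: "I \<in> \<I>" "Z \<subseteq> I" unfolding Z_def by blast
    have "F \<subseteq> ?H I" unfolding FZ by (intro hull_mono image_mono I)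
    then have FG: "F face_of ?H I"
      by (rule face_of_subset[OF facet_of_imp_face_of[OF F]]) (rule face_of_imp_subset[OF face[OF I(1)]])
    have "F = ?H I"
    proof (rule ccontr)
      assume "F \<noteq> ?H I"
      then have "aff_dim F < aff_dim (?H I)"
        by (intro face_of_aff_dim_lt FG convex_convex_hull)
      moreover have "aff_dim (?H I) < aff_dim ?P"
        by (intro face_of_aff_dim_lt face proper convex_convex_hull I(1))
      ultimately show False using F by (simp add: facet_of_def)
    qed
    with I show ?thesis by blast
  qed
  moreover have "?H I facet_of ?P" if I: "I \<in> \<I>" for I
  proof -
    have "?H I \<noteq> {}" using supp[OF I] by simp
    then obtain F where F: "F facet_of ?P" "?H I \<subseteq> F"
      using face_of_polyhedron_subset_facet[OF poly face[OF I]] proper[OF I] by blast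
    obtain J where J: "J \<in> \<I>" "F = ?H J" using facet_in[OF F(1)] by blast
    have "I \<subseteq> J"
    proof
      fix i assume "i \<in> I"
      then have "i \<in> N" "e i \<in> ?H J"
        using supp[OF I] F(2) J(2) by (auto simp: hull_inc subset_iff)
      then show "i \<in> J" using mem[OF J(1)] by blast
    qed
    then have "I = J" using antichain I J by blast
    with F J show ?thesis by simp
  qed
  ultimately show "{F. F facet_of ?P} = ?H ` \<I>" by blast
qed

text \<open>By strict convexity no point of a sphere lies in an open segment between points of the
  ball.\<close>

lemma extreme_points_of_convex_hull_sphere:
  fixes S :: "'a::euclidean_space set"
  assumes "S \<subseteq> sphere 0 r"
  shows "{x. x extreme_point_of convex hull S} = S"
proof
  show "{x. x extreme_point_of convex hull S} \<subseteq> S"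
    by (rule extreme_points_of_convex_hull)
  have ball: "convex hull S \<subseteq> cball 0 r"
    by (rule hull_minimal) (use assms in auto)
  show "S \<subseteq> {x. x extreme_point_of convex hull S}"
  proof
    fix x assume x: "x \<in> S"
    have "x \<notin> open_segment a b" if "a \<in> convex hull S" "b \<in> convex hull S" for a b
    proof
      assume "x \<in> open_segment a b"
      then have "norm x < norm a \<or> norm x < norm b"
        using dist_decreases_open_segment[of x a b 0] by simp
      moreover have "norm x = r" "norm a \<le> r" "norm b \<le> r"
        using x assms that ball by auto
      ultimately show False by linarith
    qed
    then show "x \<in> {x. x extreme_point_of convex hull S}"
      using x by (simp add: extreme_point_of_def hull_inc)
  qed
qed

section \<open>Families and sign patterns\<close>

text \<open>Number of the off-diagonal position, in the order (1,2), (1,3), (2,3), of the entry \<open>\<plusminus>\<delta>\<close>; then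
  \<open>\<beta>\<close> is the diagonal entry in the row that this position avoids.\<close>

definition family :: "nat \<Rightarrow> 3" where
  "family i = (if i \<le> 4 then 1 else if i \<le> 8 then 2 else 3)"

text \<open>The signs of the entries (1,2), (1,3), (2,3).\<close>

definition signs :: "nat \<Rightarrow> real^3" where
  "signs i =
    [vector [1, 1, 1], vector [1, -1, -1], vector [-1, -1, 1], vector [-1, 1, -1],
     vector [1, 1, 1], vector [-1, 1, -1], vector [-1, -1, 1], vector [1, -1, -1],
     vector [1, 1, 1], vector [-1, -1, 1], vector [-1, 1, -1], vector [1, -1, -1]] ! (i - 1)"

text \<open>Two different sign patterns with product \<open>1\<close> agree in exactly one position \<open>l\<close>, so they differ by
  a factor \<open>flip l\<close>.\<close>

definition flip :: "3 \<Rightarrow> 3 \<Rightarrow> real" where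
  "flip l l' = (if l' = l then 1 else -1)"

lemma indices: "{1..12::nat} = {1,2,3,4,5,6,7,8,9,10,11,12}"
  by (auto; presburger)

lemma indices4: "{1..4::nat} = {1,2,3,4}"
  by auto

lemma ball_indices:
  "(\<forall>i\<in>{1..12}. P i) \<longleftrightarrow> P 1 \<and> P 2 \<and> P 3 \<and> P 4 \<and> P 5 \<and> P 6 \<and> P 7 \<and> P 8 \<and> P 9 \<and>
     P 10 \<and> P 11 \<and> P (12::nat)"
  unfolding indices by simp

lemma family_simps [simp]:
  "family 1 = 1" "family (Suc 0) = 1" "family 2 = 1" "family 3 = 1" "family 4 = 1"
  "family 5 = 2" "family 6 = 2" "family 7 = 2" "family 8 = 2"
  "family 9 = 3" "family 10 = 3" "family 11 = 3" "family 12 = 3"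
  by (simp_all add: family_def)

lemma signs_simps [simp]:
  "signs 1 = vector [1, 1, 1]" "signs (Suc 0) = vector [1, 1, 1]" "signs 2 = vector [1, -1, -1]"
  "signs 3 = vector [-1, -1, 1]" "signs 4 = vector [-1, 1, -1]"
  "signs 5 = vector [1, 1, 1]" "signs 6 = vector [-1, 1, -1]"
  "signs 7 = vector [-1, -1, 1]" "signs 8 = vector [1, -1, -1]"
  "signs 9 = vector [1, 1, 1]" "signs 10 = vector [-1, -1, 1]"
  "signs 11 = vector [-1, 1, -1]" "signs 12 = vector [1, -1, -1]"
  by (simp_all add: signs_def)

lemma signs_cases: "i \<in> {1..12} \<Longrightarrow> signs i $ l = 1 \<or> signs i $ l = -1"
proof -
  have "\<forall>i\<in>{1..12}. \<forall>l. signs i $ l = 1 \<or> signs i $ l = -1"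
    unfolding ball_indices forall_3 by simp
  then show "i \<in> {1..12} \<Longrightarrow> ?thesis" by blast
qed

lemma signs_square: "i \<in> {1..12} \<Longrightarrow> signs i $ l * signs i $ l = 1"
  using signs_cases[of i l] by auto

lemma signs_prod: "i \<in> {1..12} \<Longrightarrow> signs i $ 1 * signs i $ 2 * signs i $ 3 = 1"
proof -
  have "\<forall>i\<in>{1..12}. signs i $ 1 * signs i $ 2 * signs i $ 3 = 1"
    unfolding ball_indices by simp
  then show "i \<in> {1..12} \<Longrightarrow> ?thesis" by blast
qed

lemma relative_signs:
  assumes "i \<in> {1..12}" "j \<in> {1..12}"
  shows "(\<forall>l. signs i $ l = signs j $ l) \<or> (\<exists>l. \<forall>l'. signs i $ l' = flip l l' * signs j $ l')"
proof -
  have "(\<forall>l. signs i $ l = signs j $ l) \<or> (\<forall>l'. signs i $ l' = flip 1 l' * signs j $ l')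
      \<or> (\<forall>l'. signs i $ l' = flip 2 l' * signs j $ l') \<or> (\<forall>l'. signs i $ l' = flip 3 l' * signs j $ l')"
    using signs_cases[OF assms(1), of 1] signs_cases[OF assms(1), of 2] signs_cases[OF assms(1), of 3]
      signs_cases[OF assms(2), of 1] signs_cases[OF assms(2), of 2] signs_cases[OF assms(2), of 3]
      signs_prod[OF assms(1)] signs_prod[OF assms(2)]
    unfolding forall_3 flip_def by (elim disjE) simp_all
  then show ?thesis by blast
qed

lemma flip_signs_neq:
  assumes "j \<in> {1..12}" "\<forall>l'. signs i $ l' = flip l l' * signs j $ l'"
  shows "signs i \<noteq> signs j"
proof
  assume eq: "signs i = signs j"
  have "(1::3) \<noteq> 2" by simp
  then obtain l' where "l' \<noteq> l" by metis
  then have "signs j $ l' = - signs j $ l'"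
    using assms(2)[rule_format, of l'] by (simp add: eq flip_def)
  then show False using signs_cases[OF assms(1), of l'] by auto
qed

lemma index_exists:
  assumes "y \<in> {1..4}"
  shows "\<exists>j\<in>{1..12}. family j = k \<and> (\<forall>l. signs j $ l = signs y $ l)"
    and "\<exists>j\<in>{1..12}. family j = k \<and> (\<forall>l'. signs j $ l' = flip l l' * signs y $ l')"
proof -
  have "\<forall>y\<in>{1..4}. \<forall>k. \<exists>j\<in>{1..12}. family j = k \<and> (\<forall>l. signs j $ l = signs y $ l)"
    unfolding indices indices4 forall_3 by simp
  then show "\<exists>j\<in>{1..12}. family j = k \<and> (\<forall>l. signs j $ l = signs y $ l)"
    using assms by blast
  have "\<forall>y\<in>{1..4}. \<forall>k l. \<exists>j\<in>{1..12}. family j = k \<and> (\<forall>l'. signs j $ l' = flip l l' * signs y $ l')"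
    unfolding indices indices4 forall_3 flip_def by simp
  then show "\<exists>j\<in>{1..12}. family j = k \<and> (\<forall>l'. signs j $ l' = flip l l' * signs y $ l')"
    using assms by blast
qed

text \<open>Reversing two signs at a time makes \<open>c\<close> nonnegative if it has a zero entry or an even number of
  negative entries, and negative otherwise.\<close>

lemma sign_normalization:
  fixes c :: "real^3"
  obtains y a where "y \<in> {1..4}" "c = (\<chi> l. - signs y $ l * a l)" "(\<forall>l. a l \<le> 0) \<or> (\<forall>l. a l > 0)"
proof -
  have "\<exists>y\<in>{1..4}. (\<forall>l. - signs y $ l * c $ l \<le> 0) \<or> (\<forall>l. - signs y $ l * c $ l > 0)"
  proof -
    have "(c$1 \<ge> 0 \<and> c$2 \<ge> 0 \<and> c$3 \<ge> 0) \<or> (c$1 < 0 \<and> c$2 < 0 \<and> c$3 < 0)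
        \<or> (c$1 \<ge> 0 \<and> c$2 \<le> 0 \<and> c$3 \<le> 0) \<or> (c$1 < 0 \<and> c$2 > 0 \<and> c$3 > 0)
        \<or> (c$1 \<le> 0 \<and> c$2 \<le> 0 \<and> c$3 \<ge> 0) \<or> (c$1 > 0 \<and> c$2 > 0 \<and> c$3 < 0)
        \<or> (c$1 \<le> 0 \<and> c$2 \<ge> 0 \<and> c$3 \<le> 0) \<or> (c$1 > 0 \<and> c$2 < 0 \<and> c$3 > 0)"
      by (smt (verit))
    then show ?thesis
      unfolding indices4 forall_3 by simp
  qed
  then obtain y where y: "y \<in> {1..4}"
      "(\<forall>l. - signs y $ l * c $ l \<le> 0) \<or> (\<forall>l. - signs y $ l * c $ l > 0)" by blast
  have "c = (\<chi> l. - signs y $ l * (- signs y $ l * c $ l))"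
    using y(1) signs_square[of y] by (auto simp: vec_eq_iff mult.assoc[symmetric])
  from that[OF y(1) this y(2)] show ?thesis .
qed

section \<open>The listed index sets in terms of families and signs\<close>

definition eight_set :: "3 \<Rightarrow> nat set" where
  "eight_set k = {i \<in> {1..12}. family i \<noteq> k}"

text \<open>Two of the four sign patterns qualify, so this is the union of two compatible triples.\<close>

definition half_set :: "3 \<Rightarrow> real \<Rightarrow> nat set" where
  "half_set m \<sigma> = {i \<in> {1..12}. signs i $ m = \<sigma>}"

text \<open>The entry \<open>\<plusminus>\<delta>\<close> carries the sign given by the odd pattern \<open>- signs y\<close>.  Such a strain arises from
  that pattern by reversing the sign of one of the entries \<open>\<plusminus>\<epsilon>\<close>.\<close>

definition T3_set :: "nat \<Rightarrow> nat set" where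
  "T3_set y = {i \<in> {1..12}. signs i $ family i = - signs y $ family i}"

text \<open>The strains that arise from the odd pattern \<open>- signs y\<close> by reversing one sign: an arbitrary one
  in family \<open>m\<close>, and the one at position \<open>m\<close> in the other two families.\<close>

definition simplex_set :: "3 \<Rightarrow> nat \<Rightarrow> nat set" where
  "simplex_set m y = {i \<in> {1..12}.
     if family i = m then signs i \<noteq> signs y else \<forall>l. signs i $ l = flip m l * signs y $ l}"

lemma filter_indices_eqI:
  assumes "J \<subseteq> {1..12::nat}" "\<forall>i\<in>{1..12}. P i \<longleftrightarrow> i \<in> J"
  shows "{i \<in> {1..12}. P i} = J"
  using assms by auto

lemma eight_set_simps:
  "eight_set 1 = {5,6,7,8,9,10,11,12}" "eight_set 2 = {1,2,3,4,9,10,11,12}"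
  "eight_set 3 = {1,2,3,4,5,6,7,8}"
  unfolding eight_set_def by ((rule filter_indices_eqI, simp), unfold ball_indices, simp)+

lemma half_set_simps:
  "half_set 1 1 = {1,2,5,8,9,12}" "half_set 1 (-1) = {3,4,6,7,10,11}"
  "half_set 2 1 = {1,4,5,6,9,11}" "half_set 2 (-1) = {2,3,7,8,10,12}"
  "half_set 3 1 = {1,3,5,7,9,10}" "half_set 3 (-1) = {2,4,6,8,11,12}"
  unfolding half_set_def by ((rule filter_indices_eqI, simp), unfold ball_indices, simp)+

lemma T3_set_simps:
  "T3_set 1 = {3,4,7,8,11,12}" "T3_set (Suc 0) = {3,4,7,8,11,12}" "T3_set 2 = {3,4,5,6,9,10}"
  "T3_set 3 = {1,2,5,6,11,12}" "T3_set 4 = {1,2,7,8,9,10}"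
  unfolding T3_set_def by ((rule filter_indices_eqI, simp), unfold ball_indices, simp)+

lemma simplex_set_simps:
  "simplex_set 1 1 = {2,3,4,8,12}" "simplex_set 1 (Suc 0) = {2,3,4,8,12}"
  "simplex_set 1 2 = {1,3,4,5,9}" "simplex_set 1 3 = {1,2,4,6,11}" "simplex_set 1 4 = {1,2,3,7,10}"
  "simplex_set 2 1 = {4,6,7,8,11}" "simplex_set 2 (Suc 0) = {4,6,7,8,11}"
  "simplex_set 2 2 = {3,5,6,7,10}" "simplex_set 2 3 = {2,5,6,8,12}" "simplex_set 2 4 = {1,5,7,8,9}"
  "simplex_set 3 1 = {3,7,10,11,12}" "simplex_set 3 (Suc 0) = {3,7,10,11,12}"
  "simplex_set 3 2 = {4,6,9,10,11}" "simplex_set 3 3 = {1,5,9,11,12}" "simplex_set 3 4 = {2,8,9,10,12}"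
  unfolding simplex_set_def flip_def
  by ((rule filter_indices_eqI, simp), unfold ball_indices, simp add: forall_3 vec_eq_iff)+

lemma eight_vertex_indices_eq: "eight_vertex_indices = range eight_set"
  unfolding eight_vertex_indices_def UNIV_3 by (simp add: eight_set_simps insert_commute)

lemma compatible_pair_indices_eq:
  "compatible_pair_indices = {half_set m \<sigma> | m \<sigma>. \<sigma> \<in> {1,-1}}"
proof -
  have "{half_set m \<sigma> | m \<sigma>. \<sigma> \<in> {1,-1}} = (\<lambda>m. half_set m 1) ` UNIV \<union> (\<lambda>m. half_set m (-1)) ` UNIV"
    by auto
  then show ?thesis
    unfolding compatible_pair_indices_def UNIV_3 by (simp add: half_set_simps insert_commute)
qed

lemma T3_pair_indices_eq: "T3_pair_indices = T3_set ` {1..4}"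
  unfolding T3_pair_indices_def indices4 by (simp add: T3_set_simps insert_commute)

lemma simplex_indices_eq: "simplex_indices = {simplex_set m y | m y. y \<in> {1..4}}"
proof -
  have "{simplex_set m y | m y. y \<in> {1..4}} = (\<Union>m. simplex_set m ` {1..4})"
    by blast
  then show ?thesis
    unfolding simplex_indices_def indices4 UNIV_3
    by (simp only: simplex_set_simps image_insert image_empty Union_insert Union_empty
        Un_insert_left Un_empty_left Un_empty_right insert_commute)
qed

section \<open>Tight sets of supporting functionals\<close>

definition weight :: "real \<Rightarrow> real \<Rightarrow> 3 \<Rightarrow> 3 \<Rightarrow> real" where
  "weight \<delta> \<epsilon> k l = (if l = k then \<delta> else \<epsilon>)"

text \<open>The slack at strain \<open>i\<close> of the functional with constant \<open>d $ k\<close> on family \<open>k\<close> and off-diagonal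
  coefficients \<open>c\<close>.\<close>

definition gap :: "real \<Rightarrow> real \<Rightarrow> real^3 \<Rightarrow> real^3 \<Rightarrow> nat \<Rightarrow> real" where
  "gap \<delta> \<epsilon> d c i =
     d $ family i - (\<Sum>l\<in>UNIV. weight \<delta> \<epsilon> (family i) l * signs i $ l * c $ l)"

lemma gap_same:
  assumes "y \<in> {1..12}" "\<forall>l. signs i $ l = signs y $ l"
  shows "gap \<delta> \<epsilon> d (\<chi> l. - signs y $ l * a l) i =
           d $ family i + (\<Sum>l\<in>UNIV. weight \<delta> \<epsilon> (family i) l * a l)"
proof -
  have *: "weight \<delta> \<epsilon> k l * signs y $ l * (- signs y $ l * a l) = - (weight \<delta> \<epsilon> k l * a l)" for k l
  proof -
    have "weight \<delta> \<epsilon> k l * signs y $ l * (- signs y $ l * a l) =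
        - (weight \<delta> \<epsilon> k l * a l) * (signs y $ l * signs y $ l)" by simp
    then show ?thesis by (simp add: signs_square[OF assms(1)])
  qed
  show ?thesis
    by (simp only: gap_def vec_lambda_beta assms(2)[rule_format] * sum_negf diff_minus_eq_add)
qed

lemma gap_flip:
  assumes "y \<in> {1..12}" "\<forall>l'. signs i $ l' = flip l l' * signs y $ l'"
  shows "gap \<delta> \<epsilon> d (\<chi> l. - signs y $ l * a l) i =
           d $ family i + 2 * (weight \<delta> \<epsilon> (family i) l * a l)
             - (\<Sum>l\<in>UNIV. weight \<delta> \<epsilon> (family i) l * a l)"
proof -
  have *: "weight \<delta> \<epsilon> k l' * (flip l l' * signs y $ l') * (- signs y $ l' * a l') =
      (weight \<delta> \<epsilon> k l' * a l') - (if l' = l then 2 * (weight \<delta> \<epsilon> k l' * a l') else 0)" for k l'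
  proof -
    have "weight \<delta> \<epsilon> k l' * (flip l l' * signs y $ l') * (- signs y $ l' * a l') =
        - (flip l l' * (weight \<delta> \<epsilon> k l' * a l')) * (signs y $ l' * signs y $ l')"
      by simp
    then show ?thesis by (simp add: signs_square[OF assms(1)] flip_def)
  qed
  show ?thesis
    by (simp only: gap_def vec_lambda_beta assms(2)[rule_format] * sum_subtractf) simp
qed


text \<open>Maximality over the four sign patterns of a family.  If all \<open>a l \<le> 0\<close>, the pattern \<open>signs y\<close>
  itself is optimal in each family, and every optimal pattern agrees with it at each position with
  \<open>a l \<noteq> 0\<close>.  If all \<open>a l > 0\<close>, the ideal pattern \<open>- signs y\<close> is odd and not available; the
  cheapest repair reverses its sign at a position \<open>l\<close> that minimizes the product of \<open>a l\<close> with its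
  weight, which is \<open>\<delta>\<close> at one position and the smaller number \<open>\<epsilon>\<close> elsewhere.  When \<open>a\<close> has a unique
  minimum \<open>m\<close>, the families other than \<open>m\<close> must reverse at \<open>m\<close>; when the minimum is attained twice,
  no family can reverse at its heavy position.\<close>

proposition tight_set_covered:
  assumes \<epsilon>: "0 < \<epsilon>" "\<epsilon> < \<delta>"
    and nonneg: "\<forall>i\<in>{1..12}. gap \<delta> \<epsilon> d c i \<ge> 0" and "\<exists>i\<in>{1..12}. gap \<delta> \<epsilon> d c i \<noteq> 0"
  shows "\<exists>I \<in> simplex_indices \<union> T3_pair_indices \<union> compatible_pair_indices \<union> eight_vertex_indices.
           {i \<in> {1..12}. gap \<delta> \<epsilon> d c i = 0} \<subseteq> I"
proof (cases "c = 0")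
  case True
  then have "gap \<delta> \<epsilon> d c i = d $ family i" for i by (simp add: gap_def)
  then obtain j where "j \<in> {1..12}" "d $ family j \<noteq> 0" using assms(4) by auto
  then have "{i \<in> {1..12}. gap \<delta> \<epsilon> d c i = 0} \<subseteq> eight_set (family j)"
    using True by (auto simp: gap_def eight_set_def)
  then show ?thesis unfolding eight_vertex_indices_eq by blast
next
  case False
  obtain y a where y: "y \<in> {1..4}" and c: "c = (\<chi> l. - signs y $ l * a l)"
    and a: "(\<forall>l. a l \<le> 0) \<or> (\<forall>l. a l > 0)"
    using sign_normalization .
  have y12: "y \<in> {1..12}" using y by simp
  define v where "v = (\<lambda>k l. weight \<delta> \<epsilon> k l * a l)"
  define S where "S = (\<lambda>k. \<Sum>l\<in>UNIV. v k l)"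
  have same: "gap \<delta> \<epsilon> d c i = d $ family i + S (family i)" if "\<forall>l. signs i $ l = signs y $ l" for i
    unfolding c S_def v_def using gap_same[OF y12 that] .
  have flipped: "gap \<delta> \<epsilon> d c i = d $ family i + 2 * v (family i) l - S (family i)"
    if "\<forall>l'. signs i $ l' = flip l l' * signs y $ l'" for i l
    unfolding c S_def v_def using gap_flip[OF y12 that] .
  \<comment> \<open>Each family contains all four patterns, so that nonnegativity of the gaps bounds \<open>d\<close> from below.\<close>
  have d_same: "d $ k + S k \<ge> 0" for k
    using index_exists(1)[OF y, of k] nonneg same by metis
  have d_flipped: "d $ k + 2 * v k l - S k \<ge> 0" for k l
    using index_exists(2)[OF y, of k l] nonneg flipped by metis
  have w: "weight \<delta> \<epsilon> k l > 0" for k l using \<epsilon> by (simp add: weight_def)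
  from a show ?thesis
  proof
    assume neg: "\<forall>l. a l \<le> 0"
    obtain m where m: "a m \<noteq> 0"
      using False c by (auto simp: vec_eq_iff)
    have v0: "v k l \<le> 0" for k l
      using neg w[of k l] by (simp add: v_def mult_nonneg_nonpos)
    have vm: "v k m < 0" for k
    proof -
      have "a m < 0" using neg m by (simp add: order_less_le)
      then show ?thesis using w[of k m] by (simp add: v_def mult_pos_neg)
    qed
    have "signs i $ m = signs y $ m" if i: "i \<in> {1..12}" "gap \<delta> \<epsilon> d c i = 0" for i
    proof (rule ccontr)
      assume ne: "signs i $ m \<noteq> signs y $ m"
      then obtain l where l: "\<forall>l'. signs i $ l' = flip l l' * signs y $ l'"
        using relative_signs[OF i(1) y12] by auto
      have "l \<noteq> m" using l ne by (auto simp: flip_def)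
      let ?k = "family i"
      have "v ?k l \<le> S ?k"
        using flipped[OF l] i(2) d_same[of ?k] by linarith
      moreover have "S ?k < v ?k l"
        using \<open>l \<noteq> m\<close> v0[of ?k 1] v0[of ?k 2] v0[of ?k 3] vm[of ?k] exhaust_3[of l] exhaust_3[of m]
        unfolding S_def sum_3 by auto
      ultimately show False by simp
    qed
    then have "{i \<in> {1..12}. gap \<delta> \<epsilon> d c i = 0} \<subseteq> half_set m (signs y $ m)"
      by (auto simp: half_set_def)
    moreover have "half_set m (signs y $ m) \<in> compatible_pair_indices"
      unfolding compatible_pair_indices_eq using signs_cases[OF y12, of m] by auto
    ultimately show ?thesis by blast
  next
    assume pos: "\<forall>l. a l > 0"
    have v0: "v k l > 0" for k l
      using pos w[of k l] by (simp add: v_def)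
    have active: "\<exists>l. (\<forall>l'. signs i $ l' = flip l l' * signs y $ l') \<and> (\<forall>l'. v (family i) l \<le> v (family i) l')"
      if i: "i \<in> {1..12}" "gap \<delta> \<epsilon> d c i = 0" for i
    proof -
      let ?k = "family i"
      have "\<not> (\<forall>l. signs i $ l = signs y $ l)"
      proof
        assume *: "\<forall>l. signs i $ l = signs y $ l"
        have "v ?k 1 \<ge> S ?k"
          using same[OF *] i(2) d_flipped[of ?k 1] by linarith
        then show False
          using v0[of ?k 2] v0[of ?k 3] by (simp add: S_def sum_3)
      qed
      then obtain l where l: "\<forall>l'. signs i $ l' = flip l l' * signs y $ l'"
        using relative_signs[OF i(1) y12] by auto
      have "v ?k l \<le> v ?k l'" for l'
        using flipped[OF l] i(2) d_flipped[of ?k l'] by linarith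
      with l show ?thesis by blast
    qed
    have "Min (range a) \<in> range a" by (intro Min_in) auto
    then obtain m where "a m = Min (range a)" by (metis imageE)
    then have m: "a m \<le> a l" for l by simp
    show ?thesis
    proof (cases "\<forall>l. l \<noteq> m \<longrightarrow> a m < a l")
      case True
      have "i \<in> simplex_set m y" if i: "i \<in> {1..12}" "gap \<delta> \<epsilon> d c i = 0" for i
      proof -
        obtain l where l: "\<forall>l'. signs i $ l' = flip l l' * signs y $ l'"
          "\<forall>l'. v (family i) l \<le> v (family i) l'" using active[OF i] by blast
        have "signs i \<noteq> signs y" using l(1) by (rule flip_signs_neq[OF y12])
        moreover have "l = m" if "family i \<noteq> m"
        proof (rule ccontr)
          assume "l \<noteq> m"
          have "v (family i) m < \<epsilon> * a l"
            using that True \<open>l \<noteq> m\<close> \<epsilon> by (simp add: v_def weight_def)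
          also have "\<epsilon> * a l \<le> v (family i) l"
            using pos[rule_format, of l] \<epsilon> by (simp add: v_def weight_def)
          finally show False using l(2)[rule_format, of m] by simp
        qed
        ultimately show ?thesis using i(1) l(1) by (auto simp: simplex_set_def)
      qed
      then show ?thesis unfolding simplex_indices_eq using y by blast
    next
      case False
      then obtain n where n: "n \<noteq> m" "a n = a m" using m by (metis order_less_le)
      have "i \<in> T3_set y" if i: "i \<in> {1..12}" "gap \<delta> \<epsilon> d c i = 0" for i
      proof -
        let ?k = "family i"
        obtain l where l: "\<forall>l'. signs i $ l' = flip l l' * signs y $ l'"
          "\<forall>l'. v ?k l \<le> v ?k l'" using active[OF i] by blast
        have "l \<noteq> ?k"
        proof
          assume lk: "l = ?k"
          obtain l' where l': "l' \<noteq> ?k" "a l' = a m" using n by metis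
          have "v ?k l' = \<epsilon> * a m" using l' by (simp add: v_def weight_def)
          also have "\<dots> \<le> \<epsilon> * a l" using m \<epsilon> by simp
          also have "\<dots> < v ?k l" using lk pos \<epsilon> by (simp add: v_def weight_def)
          finally show False using l(2)[rule_format, of l'] by simp
        qed
        then show ?thesis using i(1) l(1) by (auto simp: T3_set_def flip_def)
      qed
      then show ?thesis unfolding T3_pair_indices_eq using y by blast
    qed
  qed
qed

text \<open>The coefficients are the extremal ones of the covering argument: for the simplices \<open>a\<close> is
  chosen so that in family \<open>m\<close> all three weighted entries are equal to \<open>\<epsilon> \<delta>\<close>; for the pairs of
  \<open>T\<^sub>3\<close>s all entries of \<open>a\<close> are equal.\<close>

lemma supporting_functional_exists:
  assumes \<epsilon>: "0 < \<epsilon>" "\<epsilon> < \<delta>"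
    and I: "I \<in> simplex_indices \<union> T3_pair_indices \<union> compatible_pair_indices \<union> eight_vertex_indices"
  shows "\<exists>d c. \<forall>i\<in>{1..12}. gap \<delta> \<epsilon> d c i \<ge> 0 \<and> (gap \<delta> \<epsilon> d c i = 0 \<longleftrightarrow> i \<in> I)"
proof -
  consider m y where "y \<in> {1..4}" "I = simplex_set m y" | y where "y \<in> {1..4}" "I = T3_set y"
    | m \<sigma> where "\<sigma> \<in> {1,-1}" "I = half_set m \<sigma>" | k where "I = eight_set k"
    using I unfolding simplex_indices_eq T3_pair_indices_eq compatible_pair_indices_eq
      eight_vertex_indices_eq by blast
  then show ?thesis
  proof cases
    case (1 m y)
    then have y: "y \<in> {1..12}" by simp
    define a where "a = (\<lambda>l. if l = m then \<epsilon> else \<delta>)"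
    define d :: "real^3" where "d = (\<chi> k. if k = m then \<epsilon> * \<delta> else \<delta>\<^sup>2 + \<epsilon> * \<delta> - \<epsilon>\<^sup>2)"
    let ?c = "\<chi> l. - signs y $ l * a l"
    have \<delta>: "0 < \<delta>" using \<epsilon> by simp
    have prods: "\<epsilon>\<^sup>2 < \<epsilon> * \<delta>" "\<epsilon> * \<delta> < \<delta>\<^sup>2" "0 < \<epsilon> * \<delta>"
      using \<epsilon> by (simp_all add: power2_eq_square)
    have S: "(\<Sum>l\<in>UNIV. weight \<delta> \<epsilon> k l * a l) =
        (if k = m then 3 * (\<epsilon> * \<delta>) else \<delta>\<^sup>2 + \<epsilon> * \<delta> + \<epsilon>\<^sup>2)" for k
      using exhaust_3[of k] exhaust_3[of m]
      by (auto simp: sum_3 weight_def a_def power2_eq_square)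
    have v: "weight \<delta> \<epsilon> k l * a l =
        (if k = m then \<epsilon> * \<delta> else if l = m then \<epsilon>\<^sup>2 else if l = k then \<delta>\<^sup>2 else \<epsilon> * \<delta>)" for k l
      by (auto simp: weight_def a_def power2_eq_square)
    have "gap \<delta> \<epsilon> d ?c i \<ge> 0 \<and> (gap \<delta> \<epsilon> d ?c i = 0 \<longleftrightarrow> i \<in> I)" if i: "i \<in> {1..12}" for i
      using relative_signs[OF i y]
    proof
      assume s: "\<forall>l. signs i $ l = signs y $ l"
      then have eq: "signs i = signs y" by (simp add: vec_eq_iff)
      have "\<not> (\<forall>l. signs y $ l = flip m l * signs y $ l)"
        using flip_signs_neq[OF y, of y] by blast
      then have "i \<notin> I" using eq by (simp add: 1 simplex_set_def)
      moreover have "gap \<delta> \<epsilon> d ?c i > 0"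
        unfolding gap_same[OF y s] S using \<epsilon>(1) \<delta> by (auto simp: d_def add_pos_pos)
      ultimately show ?thesis by simp
    next
      assume "\<exists>l. \<forall>l'. signs i $ l' = flip l l' * signs y $ l'"
      then obtain l where s: "\<forall>l'. signs i $ l' = flip l l' * signs y $ l'" by blast
      have g: "gap \<delta> \<epsilon> d ?c i = (if family i = m \<or> l = m then 0
          else if l = family i then 2 * (\<delta>\<^sup>2 - \<epsilon>\<^sup>2) else 2 * (\<epsilon> * \<delta> - \<epsilon>\<^sup>2))"
        unfolding gap_flip[OF y s] S unfolding v by (simp add: d_def)
      have lm: "l = m \<longleftrightarrow> (\<forall>l'. signs i $ l' = flip m l' * signs y $ l')"
      proof
        assume "\<forall>l'. signs i $ l' = flip m l' * signs y $ l'"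
        then have "flip l m * signs y $ m = signs y $ m"
          using s[rule_format, of m] by (auto simp: flip_def dest!: spec[of _ m])
        then show "l = m" using signs_cases[OF y, of m] by (auto simp: flip_def split: if_splits)
      qed (use s in simp)
      have "i \<in> I \<longleftrightarrow> family i = m \<or> l = m"
        using i flip_signs_neq[OF y s] by (auto simp: 1 simplex_set_def lm)
      then show ?thesis unfolding g using prods by auto
    qed
    then show ?thesis by blast
  next
    case (2 y)
    then have y: "y \<in> {1..12}" by simp
    define d :: "real^3" where "d = (\<chi> k. \<delta>)"
    let ?c = "\<chi> l. - signs y $ l * (\<lambda>_. 1) l"
    have S: "(\<Sum>l\<in>UNIV. weight \<delta> \<epsilon> k l * (\<lambda>_. 1) l) = \<delta> + 2 * \<epsilon>" for k
      using exhaust_3[of k] by (auto simp: sum_3 weight_def)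
    have "gap \<delta> \<epsilon> d ?c i \<ge> 0 \<and> (gap \<delta> \<epsilon> d ?c i = 0 \<longleftrightarrow> i \<in> I)" if i: "i \<in> {1..12}" for i
      using relative_signs[OF i y]
    proof
      assume s: "\<forall>l. signs i $ l = signs y $ l"
      then have "i \<notin> I" using signs_cases[OF y, of "family i"] by (auto simp: 2 T3_set_def)
      moreover have "gap \<delta> \<epsilon> d ?c i > 0"
        unfolding gap_same[OF y s] S using \<epsilon> by (simp add: d_def)
      ultimately show ?thesis by simp
    next
      assume "\<exists>l. \<forall>l'. signs i $ l' = flip l l' * signs y $ l'"
      then obtain l where s: "\<forall>l'. signs i $ l' = flip l l' * signs y $ l'" by blast
      have "gap \<delta> \<epsilon> d ?c i = (if l = family i then 2 * (\<delta> - \<epsilon>) else 0)"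
        unfolding gap_flip[OF y s] S by (simp add: d_def weight_def)
      moreover have "i \<in> I \<longleftrightarrow> l \<noteq> family i"
        using i s signs_cases[OF y, of "family i"] by (auto simp: 2 T3_set_def flip_def)
      ultimately show ?thesis using \<epsilon> by auto
    qed
    then show ?thesis by blast
  next
    case (3 m \<sigma>)
    define d where "d = (\<chi> k. weight \<delta> \<epsilon> k m)"
    have g: "gap \<delta> \<epsilon> d (axis m \<sigma>) i = weight \<delta> \<epsilon> (family i) m * (1 - signs i $ m * \<sigma>)" for i
    proof -
      have "(\<Sum>l\<in>UNIV. weight \<delta> \<epsilon> (family i) l * signs i $ l * axis m \<sigma> $ l) =
          weight \<delta> \<epsilon> (family i) m * signs i $ m * \<sigma>"
        by (simp add: axis_def if_distrib[of "\<lambda>x. _ * x"] cong: if_cong)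
      then show ?thesis by (simp add: gap_def d_def right_diff_distrib)
    qed
    have "gap \<delta> \<epsilon> d (axis m \<sigma>) i \<ge> 0 \<and> (gap \<delta> \<epsilon> d (axis m \<sigma>) i = 0 \<longleftrightarrow> i \<in> I)"
      if i: "i \<in> {1..12}" for i
    proof -
      have "weight \<delta> \<epsilon> (family i) m > 0" using \<epsilon> by (simp add: weight_def)
      then show ?thesis
        using signs_cases[OF i, of m] 3(1) i by (auto simp: g 3(2) half_set_def)
    qed
    then show ?thesis by blast
  next
    case (4 k)
    have "gap \<delta> \<epsilon> (axis k 1) 0 i = (if family i = k then 1 else 0)" for i
      by (simp add: gap_def axis_def)
    then show ?thesis using 4
      by (intro exI[of _ "axis k 1"] exI[of _ 0]) (auto simp: eight_set_def)
  qed
qed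

section \<open>Functionals on the strains, and the hull\<close>

lemma strain_simps:
  "strain \<alpha> \<beta> \<delta> \<epsilon> 1 = symm33 \<alpha> \<alpha> \<beta> \<delta> \<epsilon> \<epsilon>"
  "strain \<alpha> \<beta> \<delta> \<epsilon> (Suc 0) = symm33 \<alpha> \<alpha> \<beta> \<delta> \<epsilon> \<epsilon>"
  "strain \<alpha> \<beta> \<delta> \<epsilon> 2 = symm33 \<alpha> \<alpha> \<beta> \<delta> (-\<epsilon>) (-\<epsilon>)"
  "strain \<alpha> \<beta> \<delta> \<epsilon> 3 = symm33 \<alpha> \<alpha> \<beta> (-\<delta>) (-\<epsilon>) \<epsilon>"
  "strain \<alpha> \<beta> \<delta> \<epsilon> 4 = symm33 \<alpha> \<alpha> \<beta> (-\<delta>) \<epsilon> (-\<epsilon>)"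
  "strain \<alpha> \<beta> \<delta> \<epsilon> 5 = symm33 \<alpha> \<beta> \<alpha> \<epsilon> \<delta> \<epsilon>"
  "strain \<alpha> \<beta> \<delta> \<epsilon> 6 = symm33 \<alpha> \<beta> \<alpha> (-\<epsilon>) \<delta> (-\<epsilon>)"
  "strain \<alpha> \<beta> \<delta> \<epsilon> 7 = symm33 \<alpha> \<beta> \<alpha> (-\<epsilon>) (-\<delta>) \<epsilon>"
  "strain \<alpha> \<beta> \<delta> \<epsilon> 8 = symm33 \<alpha> \<beta> \<alpha> \<epsilon> (-\<delta>) (-\<epsilon>)"
  "strain \<alpha> \<beta> \<delta> \<epsilon> 9 = symm33 \<beta> \<alpha> \<alpha> \<epsilon> \<epsilon> \<delta>"
  "strain \<alpha> \<beta> \<delta> \<epsilon> 10 = symm33 \<beta> \<alpha> \<alpha> (-\<epsilon>) (-\<epsilon>) \<delta>"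
  "strain \<alpha> \<beta> \<delta> \<epsilon> 11 = symm33 \<beta> \<alpha> \<alpha> (-\<epsilon>) \<epsilon> (-\<delta>)"
  "strain \<alpha> \<beta> \<delta> \<epsilon> 12 = symm33 \<beta> \<alpha> \<alpha> \<epsilon> (-\<epsilon>) (-\<delta>)"
  by (simp_all add: strain_def)

lemma inner_symm33:
  "A \<bullet> symm33 a b c p q s = A$1$1 * a + A$2$2 * b + A$3$3 * c
     + (A$1$2 + A$2$1) * p + (A$1$3 + A$3$1) * q + (A$2$3 + A$3$2) * s"
  by (simp add: inner_vec_def sum_3 algebra_simps)

text \<open>The gaps are exactly the slacks of affine functionals on the strains: \<open>d\<close> records the
  effect on the diagonal parts, of which there is one for each family, and \<open>c\<close> the off-diagonal
  coefficients.\<close>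

lemma strain_inner_gap:
  fixes A :: "real^3^3"
  assumes d: "d = vector [b - (A$1$1 * \<alpha> + A$2$2 * \<alpha> + A$3$3 * \<beta>),
       b - (A$1$1 * \<alpha> + A$2$2 * \<beta> + A$3$3 * \<alpha>), b - (A$1$1 * \<beta> + A$2$2 * \<alpha> + A$3$3 * \<alpha>)]"
    and c: "c = vector [A$1$2 + A$2$1, A$1$3 + A$3$1, A$2$3 + A$3$2]"
    and i: "i \<in> {1..12}"
  shows "b - A \<bullet> strain \<alpha> \<beta> \<delta> \<epsilon> i = gap \<delta> \<epsilon> d c i"
proof -
  have "\<forall>i\<in>{1..12}. b - A \<bullet> strain \<alpha> \<beta> \<delta> \<epsilon> i = gap \<delta> \<epsilon> d c i"
    unfolding ball_indices
    by (simp add: strain_simps inner_symm33 gap_def sum_3 weight_def d c)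
  then show ?thesis using i by blast
qed

text \<open>For \<open>\<alpha> \<noteq> \<beta>\<close> the three diagonals are affinely independent, so that the values \<open>d\<close>
  can be prescribed.\<close>

lemma strain_inner_realizes_gap:
  assumes "\<alpha> \<noteq> \<beta>"
  shows "\<exists>A b. \<forall>i\<in>{1..12}. b - A \<bullet> strain \<alpha> \<beta> \<delta> \<epsilon> i = gap \<delta> \<epsilon> d c i"
proof -
  define r where "r = 1 / (\<alpha> - \<beta>)"
  have r: "r * \<alpha> = 1 + r * \<beta>" using assms by (simp add: r_def field_simps)
  define A where "A = symm33 (r * d$3) (r * d$2) (r * d$1) (c$1/2) (c$2/2) (c$3/2)"
  define b where "b = \<alpha> * (r * d$1 + r * d$2 + r * d$3)"
  have "\<alpha> * (r * x) = x + \<beta> * (r * x)" for x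
    using arg_cong[OF r, of "\<lambda>t. t * x"] by (simp add: algebra_simps)
  then have "d = vector [b - (A$1$1 * \<alpha> + A$2$2 * \<alpha> + A$3$3 * \<beta>),
       b - (A$1$1 * \<alpha> + A$2$2 * \<beta> + A$3$3 * \<alpha>), b - (A$1$1 * \<beta> + A$2$2 * \<alpha> + A$3$3 * \<alpha>)]"
    by (simp add: vec_eq_iff forall_3 A_def b_def mult.commute[of _ \<alpha>] mult.commute[of _ \<beta>] distrib_left)
  moreover have "c = vector [A$1$2 + A$2$1, A$1$3 + A$3$1, A$2$3 + A$3$2]"
    by (simp add: vec_eq_iff forall_3 A_def)
  ultimately show ?thesis using strain_inner_gap by blast
qed

lemma inj_on_strain:
  assumes "\<delta> > 0" "\<epsilon> > 0" "\<alpha> \<noteq> \<beta>"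
  shows "inj_on (strain \<alpha> \<beta> \<delta> \<epsilon>) {1..12}"
  unfolding inj_on_def ball_indices
  using assms by (simp add: strain_simps symm33_eq_iff)

text \<open>All strains have the same norm.\<close>

lemma vertices_strain_hull:
  assumes "I \<subseteq> {1..12}"
  shows "vertices (convex hull (strain \<alpha> \<beta> \<delta> \<epsilon> ` I)) = strain \<alpha> \<beta> \<delta> \<epsilon> ` I"
proof -
  have "\<forall>i\<in>{1..12}. strain \<alpha> \<beta> \<delta> \<epsilon> i \<bullet> strain \<alpha> \<beta> \<delta> \<epsilon> i =
      2 * \<alpha>\<^sup>2 + \<beta>\<^sup>2 + 2 * \<delta>\<^sup>2 + 4 * \<epsilon>\<^sup>2"
    unfolding ball_indices by (simp add: strain_simps inner_symm33 power2_eq_square)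
  then have "strain \<alpha> \<beta> \<delta> \<epsilon> ` I \<subseteq> sphere 0 (sqrt (2 * \<alpha>\<^sup>2 + \<beta>\<^sup>2 + 2 * \<delta>\<^sup>2 + 4 * \<epsilon>\<^sup>2))"
    using assms by (auto simp: norm_eq_sqrt_inner)
  then show ?thesis
    unfolding vertices_def by (rule extreme_points_of_convex_hull_sphere)
qed

lemma aff_dim_strains_le: "aff_dim (strain \<alpha> \<beta> \<delta> \<epsilon> ` {1..12}) \<le> 5"
proof -
  \<comment> \<open>The symmetric matrices of trace zero have five free entries.\<close>
  define f :: "real \<times> real \<times> (real^3) \<Rightarrow> real^3^3" where
    "f = (\<lambda>(x, y, z). symm33 x y (- x - y) (z$1) (z$2) (z$3))"
  have "linear f"
    by (rule linearI) (auto simp: f_def symm33_linear symm33_eq_iff algebra_simps)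
  have "\<exists>z. strain \<alpha> \<beta> \<delta> \<epsilon> i = symm33 0 0 (2 * \<alpha> + \<beta>) 0 0 0 + f z" if "i \<in> {1..12}" for i
  proof -
    have "\<forall>i\<in>{1..12}. strain \<alpha> \<beta> \<delta> \<epsilon> i = symm33 0 0 (2 * \<alpha> + \<beta>) 0 0 0 +
        f (strain \<alpha> \<beta> \<delta> \<epsilon> i $ 1 $ 1, strain \<alpha> \<beta> \<delta> \<epsilon> i $ 2 $ 2,
           vector [strain \<alpha> \<beta> \<delta> \<epsilon> i $ 1 $ 2, strain \<alpha> \<beta> \<delta> \<epsilon> i $ 1 $ 3, strain \<alpha> \<beta> \<delta> \<epsilon> i $ 2 $ 3])"
      unfolding ball_indices by (simp add: strain_simps f_def symm33_linear symm33_eq_iff)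
    then show ?thesis using that by blast
  qed
  then have "strain \<alpha> \<beta> \<delta> \<epsilon> ` {1..12} \<subseteq> (+) (symm33 0 0 (2 * \<alpha> + \<beta>) 0 0 0) ` range f"
    by blast
  then have "aff_dim (strain \<alpha> \<beta> \<delta> \<epsilon> ` {1..12}) \<le> aff_dim (range f)"
    by (metis aff_dim_subset aff_dim_translation_eq)
  also have "\<dots> \<le> aff_dim (UNIV :: (real \<times> real \<times> (real^3)) set)"
    using \<open>linear f\<close> by (rule aff_dim_linear_image_le)
  also have "\<dots> = 5" by simp
  finally show ?thesis .
qed

section \<open>Compatibility and \<open>T\<^sub>3\<close>s among the strains\<close>

lemma strain_compatible_iff:
  assumes "i \<in> {1..12}" "j \<in> {1..12}"
  shows "compatible (strain \<alpha> \<beta> \<delta> \<epsilon> i) (strain \<alpha> \<beta> \<delta> \<epsilon> j) \<longleftrightarrow>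
    det (strain \<alpha> \<beta> \<delta> \<epsilon> i - strain \<alpha> \<beta> \<delta> \<epsilon> j) = 0"
proof -
  have "\<forall>i\<in>{1..12}. transpose (strain \<alpha> \<beta> \<delta> \<epsilon> i) = strain \<alpha> \<beta> \<delta> \<epsilon> i \<and> trace (strain \<alpha> \<beta> \<delta> \<epsilon> i) = 2 * \<alpha> + \<beta>"
    unfolding ball_indices by (simp add: strain_simps)
  then show ?thesis
    using assms compatible_iff_det_eq_0 by metis
qed

text \<open>Strains with the same sign pattern are pairwise compatible.\<close>

lemma strain_compatible_triples:
  fixes \<alpha> \<beta> \<delta> \<epsilon> :: real
  defines "e \<equiv> strain \<alpha> \<beta> \<delta> \<epsilon>"
  shows "compatible_triple (e 1) (e 5) (e 9)" "compatible_triple (e 2) (e 8) (e 12)"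
    and "compatible_triple (e 3) (e 7) (e 10)" "compatible_triple (e 4) (e 6) (e 11)"
  unfolding e_def compatible_triple_def
  by (simp_all add: strain_compatible_iff,
      simp_all add: strain_simps symm33_linear det_symm33 power2_eq_square algebra_simps)

text \<open>All these differences have determinant \<open>\<plusminus> 4 \<epsilon> ((\<alpha> - \<beta>) \<delta> + \<epsilon>\<^sup>2 - \<delta>\<^sup>2)\<close>, with one sign for each
  cyclically ordered triple.\<close>

lemma strain_T3s:
  fixes \<alpha> \<beta> \<delta> \<epsilon> :: real
  defines "e \<equiv> strain \<alpha> \<beta> \<delta> \<epsilon>"
  assumes "\<epsilon> > 0" "(\<alpha> - \<beta>) * \<delta> + \<epsilon>^2 - \<delta>^2 \<noteq> 0"
  shows "forms_T3 (e 1) (e 6) (e 12)" "forms_T3 (e 2) (e 5) (e 11)"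
    and "forms_T3 (e 1) (e 8) (e 10)" "forms_T3 (e 2) (e 7) (e 9)"
    and "forms_T3 (e 3) (e 6) (e 9)" "forms_T3 (e 4) (e 5) (e 10)"
    and "forms_T3 (e 3) (e 8) (e 11)" "forms_T3 (e 4) (e 7) (e 12)"
proof -
  define K where "K = 4 * \<epsilon> * ((\<alpha> - \<beta>) * \<delta> + \<epsilon>^2 - \<delta>^2)"
  have K: "K \<noteq> 0" "- K \<noteq> 0" using assms by (simp_all add: K_def)
  note calc = strain_simps symm33_linear det_symm33 K_def power2_eq_square algebra_simps
  show "forms_T3 (e 1) (e 6) (e 12)" "forms_T3 (e 2) (e 7) (e 9)"
      "forms_T3 (e 4) (e 5) (e 10)" "forms_T3 (e 3) (e 8) (e 11)"
    unfolding e_def by (rule forms_T3I[OF _ _ _ _ _ _ _ _ K(1)]; simp add: calc)+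
  show "forms_T3 (e 2) (e 5) (e 11)" "forms_T3 (e 1) (e 8) (e 10)"
      "forms_T3 (e 3) (e 6) (e 9)" "forms_T3 (e 4) (e 7) (e 12)"
    unfolding e_def by (rule forms_T3I[OF _ _ _ _ _ _ _ _ K(2)]; simp add: calc)+
qed

lemma six_points_image:
  assumes "inj_on e N" "distinct [i1, i2, i3, j1, j2, j3]" "{i1, i2, i3, j1, j2, j3} \<subseteq> N"
    and "I = {i1, i2, i3, j1, j2, j3}"
  shows "distinct [e i1, e i2, e i3, e j1, e j2, e j3]"
    and "e ` I = {e i1, e i2, e i3} \<union> {e j1, e j2, e j3}"
proof -
  have "inj_on e (set [i1, i2, i3, j1, j2, j3])"
    by (rule inj_on_subset[OF assms(1)]) (use assms(3) in simp)
  then have "distinct (map e [i1, i2, i3, j1, j2, j3])"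
    using assms(2) unfolding distinct_map by blast
  then show "distinct [e i1, e i2, e i3, e j1, e j2, e j3]"
    by (simp only: list.map)
qed (use assms(4) in auto)

lemma T3_pairI:
  assumes "inj_on e N" "distinct [i1, i2, i3, j1, j2, j3]" "{i1, i2, i3, j1, j2, j3} \<subseteq> N"
    and "forms_T3 (e i1) (e i2) (e i3)" "forms_T3 (e j1) (e j2) (e j3)"
    and "I = {i1, i2, i3, j1, j2, j3}"
  shows "T3_pair (e ` I)"
  using six_points_image[OF assms(1-3,6)] assms(4,5) unfolding T3_pair_def by blast

lemma compatible_triple_pairI:
  assumes "inj_on e N" "distinct [i1, i2, i3, j1, j2, j3]" "{i1, i2, i3, j1, j2, j3} \<subseteq> N"
    and "compatible_triple (e i1) (e i2) (e i3)" "compatible_triple (e j1) (e j2) (e j3)"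
    and "I = {i1, i2, i3, j1, j2, j3}"
  shows "compatible_triple_pair (e ` I)"
  using six_points_image[OF assms(1-3,6)] assms(4,5) unfolding compatible_triple_pair_def by blast

section \<open>Classification of the facets\<close>

lemma indices_antichain:
  assumes "I \<in> simplex_indices \<union> T3_pair_indices \<union> compatible_pair_indices \<union> eight_vertex_indices"
    and "J \<in> simplex_indices \<union> T3_pair_indices \<union> compatible_pair_indices \<union> eight_vertex_indices"
    and "I \<subseteq> J"
  shows "I = J"
proof -
  have "\<forall>I \<in> simplex_indices \<union> T3_pair_indices \<union> compatible_pair_indices \<union> eight_vertex_indices.
        \<forall>J \<in> simplex_indices \<union> T3_pair_indices \<union> compatible_pair_indices \<union> eight_vertex_indices.
        I \<subseteq> J \<longrightarrow> I = J"
    by code_simp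
  then show ?thesis using assms by blast
qed

lemma indices_proper:
  assumes "I \<in> simplex_indices \<union> T3_pair_indices \<union> compatible_pair_indices \<union> eight_vertex_indices"
  shows "I \<noteq> {} \<and> I \<subset> {1..12}"
proof -
  have "\<forall>I \<in> simplex_indices \<union> T3_pair_indices \<union> compatible_pair_indices \<union> eight_vertex_indices.
        I \<noteq> {} \<and> I \<subset> {1..12}"
    by code_simp
  then show ?thesis using assms by blast
qed

lemma card_indices:
  "card simplex_indices = 12" "card T3_pair_indices = 4"
  "card compatible_pair_indices = 6" "card eight_vertex_indices = 3"
  "card (simplex_indices \<union> T3_pair_indices \<union> compatible_pair_indices \<union> eight_vertex_indices) = 25"
  by code_simp+

lemma card_members:
  "\<forall>I \<in> simplex_indices. card I = 5" "\<forall>I \<in> eight_vertex_indices. card I = 8"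
  by code_simp+

lemma r0_invariant:
  "\<forall>I \<in> T3_pair_indices. r0 ` I = I" "\<forall>I \<in> eight_vertex_indices. r0 ` I = I"
  by code_simp+

theorem mainTheorem3:
  fixes \<alpha> \<beta> \<delta> \<epsilon> :: real
  assumes "\<delta> > 0" and "\<epsilon> > 0"
    and "\<alpha> \<noteq> \<beta>"
    and "(\<alpha> - \<beta>) * \<delta> + \<epsilon>^2 - \<delta>^2 \<noteq> 0"
    and "\<epsilon> < \<delta>"
  shows "let e = strain \<alpha> \<beta> \<delta> \<epsilon>;
             P = convex hull (e ` {1..12});
             H = (\<lambda>I. convex hull (e ` I))
         in
           {F. F facet_of P} =
             H ` (simplex_indices \<union> T3_pair_indices \<union>
                  compatible_pair_indices \<union> eight_vertex_indices) \<and>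
           card {F. F facet_of P} = 25 \<and>
           (\<forall>F. F facet_of P \<longrightarrow> aff_dim F = 4) \<and>
           card (H ` simplex_indices) = 12 \<and>
           (\<forall>I \<in> simplex_indices. card (vertices (H I)) = 5) \<and>
           card (H ` T3_pair_indices) = 4 \<and>
           (\<forall>I \<in> T3_pair_indices. T3_pair (vertices (H I)) \<and> r0 ` I = I) \<and>
           card (H ` compatible_pair_indices) = 6 \<and>
           (\<forall>I \<in> compatible_pair_indices. compatible_triple_pair (vertices (H I))) \<and>
           card (H ` eight_vertex_indices) = 3 \<and>
           (\<forall>I \<in> eight_vertex_indices. card (vertices (H I)) = 8 \<and> r0 ` I = I)"
proof -
  define e where "e = strain \<alpha> \<beta> \<delta> \<epsilon>"
  define P where "P = convex hull (e ` {1..12})"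
  define H where "H = (\<lambda>I. convex hull (e ` I))"
  define \<I> where "\<I> = simplex_indices \<union> T3_pair_indices \<union>
                  compatible_pair_indices \<union> eight_vertex_indices"
  have proper: "I \<noteq> {} \<and> I \<subset> {1..12}" if "I \<in> \<I>" for I
    using indices_proper that unfolding \<I>_def .
  have inj_e: "inj_on e {1..12}"
    unfolding e_def using assms by (intro inj_on_strain)

  have supp: "I \<noteq> {} \<and> I \<subset> {1..12} \<and>
      (\<exists>A b. \<forall>i\<in>{1..12}. A \<bullet> e i \<le> b \<and> (A \<bullet> e i = b \<longleftrightarrow> i \<in> I))" if I: "I \<in> \<I>" for I
  proof -
    obtain d c where dc: "\<forall>i\<in>{1..12}. gap \<delta> \<epsilon> d c i \<ge> 0 \<and> (gap \<delta> \<epsilon> d c i = 0 \<longleftrightarrow> i \<in> I)"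
      using supporting_functional_exists[OF assms(2,5)] I unfolding \<I>_def by blast
    obtain A b where Ab: "\<forall>i\<in>{1..12}. b - A \<bullet> e i = gap \<delta> \<epsilon> d c i"
      using strain_inner_realizes_gap[OF assms(3)] unfolding e_def by blast
    have "A \<bullet> e i \<le> b \<and> (A \<bullet> e i = b \<longleftrightarrow> i \<in> I)" if "i \<in> {1..12}" for i
      using dc[rule_format, OF that] Ab[rule_format, OF that] by auto
    then show ?thesis using proper[OF I] by blast
  qed
  have cover: "\<exists>I\<in>\<I>. {i\<in>{1..12}. A \<bullet> e i = b} \<subseteq> I"
    if le: "\<forall>i\<in>{1..12}. A \<bullet> e i \<le> b" and ne: "\<exists>i\<in>{1..12}. A \<bullet> e i \<noteq> b" for A b
  proof -
    obtain d c where dc: "b - A \<bullet> e i = gap \<delta> \<epsilon> d c i" if "i \<in> {1..12}" for i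
      using strain_inner_gap[OF refl refl] unfolding e_def by blast
    have "\<exists>I\<in>\<I>. {i \<in> {1..12}. gap \<delta> \<epsilon> d c i = 0} \<subseteq> I"
      unfolding \<I>_def
    proof (rule tight_set_covered[OF assms(2,5)])
      show "\<forall>i\<in>{1..12}. 0 \<le> gap \<delta> \<epsilon> d c i"
        using le by (simp flip: dc)
      show "\<exists>i\<in>{1..12}. gap \<delta> \<epsilon> d c i \<noteq> 0"
      proof -
        obtain i where "i \<in> {1..12}" "A \<bullet> e i \<noteq> b" using ne by blast
        then show ?thesis using dc[of i] by (intro bexI[of _ i]) auto
      qed
    qed
    moreover have "{i\<in>{1..12}. A \<bullet> e i = b} = {i \<in> {1..12}. gap \<delta> \<epsilon> d c i = 0}"
      by (auto simp flip: dc)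
    ultimately show ?thesis by simp
  qed
  have antichain: "I = J" if "I \<in> \<I>" "J \<in> \<I>" "I \<subseteq> J" for I J
    using indices_antichain that unfolding \<I>_def .
  note hull_facts = facets_of_convex_hull_eqI[OF finite_atLeastAtMost, where \<I> = \<I> and e = e,
      OF supp cover antichain]
  have facets: "{F. F facet_of P} = H ` \<I>"
    unfolding P_def H_def by (rule hull_facts(1))
  have mem: "e i \<in> H I \<longleftrightarrow> i \<in> I" if "I \<in> \<I>" "i \<in> {1..12}" for I i
    unfolding H_def using that by - (rule hull_facts(2), assumption+)
  have face: "H I face_of P" if "I \<in> \<I>" for I
    unfolding P_def H_def using that by - (rule hull_facts(3), assumption+)

  have aff_dim_P: "aff_dim P = 5"
  proof (rule antisym)
    show "aff_dim P \<le> 5"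
      unfolding P_def e_def aff_dim_convex_hull by (rule aff_dim_strains_le)
    have step: "aff_dim (F \<inter> H I) < aff_dim F \<and> F \<inter> H I face_of P"
      if F: "F face_of P" and I: "I \<in> \<I>" "i \<in> {1..12}" "i \<notin> I" "e i \<in> F" for F I i
    proof -
      have "F \<inter> H I face_of P" using F face[OF I(1)] by (rule face_of_Int)
      moreover from this have "F \<inter> H I face_of F"
        using face_of_subset face_of_imp_subset[OF F] by blast
      moreover have "F \<inter> H I \<noteq> F" using mem[OF I(1,2)] I(3,4) by blast
      ultimately show ?thesis
        using face_of_aff_dim_lt face_of_imp_convex[OF F] by blast
    qed
    have in\<I>: "{1,2,3,7,10} \<in> \<I>" "{1,2,3,4,5,6,7,8} \<in> \<I>" "{1,2,3,4,9,10,11,12} \<in> \<I>"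
        "{1,2,5,6,11,12} \<in> \<I>" "{1,3,4,5,9} \<in> \<I>"
      unfolding \<I>_def simplex_indices_def eight_vertex_indices_def T3_pair_indices_def by simp_all
    have in_P: "e i \<in> P" if "i \<in> {1..12}" for i
      using that by (simp add: P_def hull_inc)
    have "P face_of P" by (simp add: P_def face_of_refl)
    \<comment> \<open>Intersecting with one facet after another gives a chain of faces with index sets
      \<open>{1,2,3,7,10}\<close>, \<open>{1,2,3,7}\<close>, \<open>{1,2,3}\<close>, \<open>{1,2}\<close>, \<open>{1}\<close>; each step loses a vertex, hence a dimension.\<close>
    note F1 = step[OF this in\<I>(1), of 4]
    note F2 = step[OF conjunct2[OF F1] in\<I>(2), of 10]
    note F3 = step[OF conjunct2[OF F2] in\<I>(3), of 7]
    note F4 = step[OF conjunct2[OF F3] in\<I>(4), of 3]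
    note F5 = step[OF conjunct2[OF F4] in\<I>(5), of 2]
    let ?F = "P \<inter> H {1,2,3,7,10} \<inter> H {1,2,3,4,5,6,7,8} \<inter> H {1,2,3,4,9,10,11,12} \<inter> H {1,2,5,6,11,12}"
    have "e 1 \<in> ?F \<inter> H {1,3,4,5,9}"
      using in_P[of 1] mem[of _ 1] in\<I> by simp
    then have "?F \<inter> H {1,3,4,5,9} \<noteq> {}" by blast
    then have "aff_dim (?F \<inter> H {1,3,4,5,9}) \<ge> 0"
      using aff_dim_negative_iff[of "?F \<inter> H {1,3,4,5,9}"] by linarith
    then show "aff_dim P \<ge> 5"
      using F1 F2 F3 F4 F5 in_P mem in\<I> by simp
  qed

  have vert: "vertices (H I) = e ` I" if "I \<in> \<I>" for I
    unfolding H_def e_def using proper[OF that] by (intro vertices_strain_hull) blast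
  have inj_H: "inj_on H \<I>"
  proof (rule inj_onI)
    fix I J assume IJ: "I \<in> \<I>" "J \<in> \<I>" "H I = H J"
    then have "e ` I = e ` J" using vert by metis
    then show "I = J"
      using inj_on_image_eq_iff[OF inj_e] proper IJ(1,2) by blast
  qed
  have card_H: "card (H ` \<J>) = card \<J>" if "\<J> \<subseteq> \<I>" for \<J>
    using inj_on_subset[OF inj_H that] by (rule card_image)
  have card_vert: "card (vertices (H I)) = card I" if "I \<in> \<I>" for I
    unfolding vert[OF that] using proper[OF that] inj_on_subset[OF inj_e] by (intro card_image) blast
  have subs: "simplex_indices \<subseteq> \<I>" "T3_pair_indices \<subseteq> \<I>"
      "compatible_pair_indices \<subseteq> \<I>" "eight_vertex_indices \<subseteq> \<I>"
    unfolding \<I>_def by auto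

  have T3: "T3_pair (vertices (H I))" if I: "I \<in> T3_pair_indices" for I
  proof -
    note T = strain_T3s[OF assms(2,4), of, folded e_def]
    have "T3_pair (e ` I)"
      using I unfolding T3_pair_indices_def
    proof (elim insertE emptyE)
      assume "I = {1,2,5,6,11,12}" then show ?thesis
        by (intro T3_pairI[OF inj_e _ _ T(1) T(2)]) auto
    next
      assume "I = {1,2,7,8,9,10}" then show ?thesis
        by (intro T3_pairI[OF inj_e _ _ T(3) T(4)]) auto
    next
      assume "I = {3,4,5,6,9,10}" then show ?thesis
        by (intro T3_pairI[OF inj_e _ _ T(5) T(6)]) auto
    next
      assume "I = {3,4,7,8,11,12}" then show ?thesis
        by (intro T3_pairI[OF inj_e _ _ T(7) T(8)]) auto
    qed
    then show ?thesis using vert I subs by auto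
  qed
  have pairs: "compatible_triple_pair (vertices (H I))" if I: "I \<in> compatible_pair_indices" for I
  proof -
    note C = strain_compatible_triples[of \<alpha> \<beta> \<delta> \<epsilon>, folded e_def]
    have "compatible_triple_pair (e ` I)"
      using I unfolding compatible_pair_indices_def
    proof (elim insertE emptyE)
      assume "I = {1,2,5,8,9,12}" then show ?thesis
        by (intro compatible_triple_pairI[OF inj_e _ _ C(1) C(2)]) auto
    next
      assume "I = {1,3,5,7,9,10}" then show ?thesis
        by (intro compatible_triple_pairI[OF inj_e _ _ C(1) C(3)]) auto
    next
      assume "I = {1,4,5,6,9,11}" then show ?thesis
        by (intro compatible_triple_pairI[OF inj_e _ _ C(1) C(4)]) auto
    next
      assume "I = {2,3,7,8,10,12}" then show ?thesis
        by (intro compatible_triple_pairI[OF inj_e _ _ C(2) C(3)]) auto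
    next
      assume "I = {2,4,6,8,11,12}" then show ?thesis
        by (intro compatible_triple_pairI[OF inj_e _ _ C(2) C(4)]) auto
    next
      assume "I = {3,4,6,7,10,11}" then show ?thesis
        by (intro compatible_triple_pairI[OF inj_e _ _ C(3) C(4)]) auto
    qed
    then show ?thesis using vert I subs by auto
  qed

  have "card {F. F facet_of P} = 25"
    unfolding facets using card_H[OF subset_refl] card_indices(5) by (simp add: \<I>_def)
  moreover have "\<forall>F. F facet_of P \<longrightarrow> aff_dim F = 4"
    using aff_dim_P by (simp add: facet_of_def)
  moreover have "\<forall>I \<in> simplex_indices. card (vertices (H I)) = 5"
      "\<forall>I \<in> eight_vertex_indices. card (vertices (H I)) = 8"
    using card_vert subs card_members by (auto simp: subset_iff)
  moreover have "card (H ` simplex_indices) = 12" "card (H ` T3_pair_indices) = 4"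
      "card (H ` compatible_pair_indices) = 6" "card (H ` eight_vertex_indices) = 3"
    using card_H subs card_indices by simp_all
  ultimately show ?thesis
    unfolding Let_def e_def[symmetric] P_def[symmetric] H_def[symmetric] \<I>_def[symmetric]
    using facets T3 pairs r0_invariant by (simp add: H_def)
qed

end
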